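(* Consider the three-qubit system with algebra $\mathcal A=M_2\otimes M_2\otimes M_2$ and state space $\mathcal M(\mathcal A)$ with the norm topology. Let $\mathcal H_2$ be the real vector space of $2$-local Hamiltonians, $\mathcal E(\mathcal H_2)=\{e^H/\operatorname{tr}(e^H)\mid H\in\mathcal H_2\}$, let ${\rm d}_{\mathcal E(\mathcal H_2)}$ be the divergence from $\mathcal E(\mathcal H_2)$, and let $C_3$ be the $3$-body irreducible correlation. Then the function $C_3={\rm d}_{\mathcal E(\mathcal H_2)}:\mathcal M(\mathcal A)\to\mathbb R$ is discontinuous, that is, there exists a state $\sigma\in\mathcal M(\mathcal A)$ at which it is not continuous.
   Context: $M_2$ is the algebra of complex $2\times2$ matrices; $\mathcal A=M_2^{\otimes 3}$ is identified with the algebra $M_8$ of complex $8\times 8$ matrices, and $\mathcal M(\mathcal A)=\{\rho\in\mathcal A\mid\rho\succeq0,\ \operatorname{tr}(\rho)=1\}$ is the set of density matrices (states). Hermitian matrices carry the scalar product $\langle a,b\rangle=\operatorname{tr}(ab)$. For $A\subset\{1,2,3\}$ let $\mathcal A_A=\bigotimes_{i\in A}M_2$ with identity $\mathbb 1_A$. For $k\in\{1,2,3\}$, a $k$-local Hamiltonian is a sum of terms of the form $\mathbb 1_{\{1,2,3\}\setminus A}\otimes b$ (tensor factors placed in their respective positions) with $b\in\mathcal A_A$ Hermitian and $|A|\leq k$; $\mathcal H_k$ is the real vector space of $k$-local Hamiltonians, so $\mathcal H_3$ consists of all Hermitian matrices in $\mathcal A$. The Gibbs family of $\mathcal H_k$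 is $\mathcal E(\mathcal H_k)=\{e^H/\operatorname{tr}(e^H)\mid H\in\mathcal H_k\}$. The von Neumann entropy is $H(\rho)=-\operatorname{tr}\rho\log(\rho)$ (with $0\log0=0$). The relative entropy (divergence) is $D(\rho,\sigma)=\operatorname{tr}\rho(\log(\rho)-\log(\sigma))$ if $\ker(\sigma)\subset\ker(\rho)$ and $D(\rho,\sigma)=+\infty$ otherwise. The divergence from a set $X$ of states is ${\rm d}_X(\rho)=\inf\{D(\rho,\sigma)\mid\sigma\in X\}$. The projection $\pi_{\mathcal E(\mathcal H)}$: let $d=8$, let $\mathcal M_d=\mathcal M(\mathcal A)$, let $\mathcal H$ be a real subspace of the Hermitian matrices in $M_d$ with basis $H_1,\ldots,H_r$, and let $\mathbb E(a)=(\langle H_1,a\rangle,\ldots,\langle H_r,a\rangle)$ for Hermitian $a$, with convex support $\mathbb L=\mathbb E(\mathcal M_d)$. A face of a compact convex set $C$ is a convex subset $F\subset C$ such that every segment in $C$ whose relative interior meets $F$ is contained in $F$. For a non-zero projection $p=p^2=p^*\in M_d$ let $\mathcal M(pM_dp)=\{\rho\in pM_dp\mid\rho\succeq0,\ \operatorname{tr}(\rho)=1\}$ and $\mathcal E_p=\{pe^{pHp}/\operatorname{tr}(pe^{pHp})\mid H\in\mathcal H\}$. Let $\mathcal P$ be the set of projections $p$ such that $\mathcal M(pM_dp)=\mathbb E|_{\mathcal M_d}^{-1}(F)$ for some non-empty face $F$ of $\mathbb L$, and let $\operatorname{ext}(\mathcal E(\mathcal H))=\bigcup_{p\in\mathcal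 P}\mathcal E_p$. It is known that $\mathbb E$ restricts to a bijection $\operatorname{ext}(\mathcal E(\mathcal H))\to\mathbb L$; $\pi_{\mathcal E(\mathcal H)}(\rho)$ is the unique state in $\operatorname{ext}(\mathcal E(\mathcal H))$ with $\mathbb E(\pi_{\mathcal E(\mathcal H)}(\rho))=\mathbb E(\rho)$. It is known that, equivalently, $\pi_{\mathcal E(\mathcal H)}(\rho)$ is the unique state of maximal von Neumann entropy among all states $\tau$ with $\mathbb E(\tau)=\mathbb E(\rho)$; for $\mathcal H=\mathcal H_2$ this condition means that $\tau$ and $\rho$ have the same two-qubit marginals (reduced density matrices). The $3$-body irreducible correlation is $C_3(\rho)=H(\pi_{\mathcal E(\mathcal H_2)}(\rho))-H(\pi_{\mathcal E(\mathcal H_3)}(\rho))$ for $\rho\in\mathcal M(\mathcal A)$. *)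

theory Defs
  imports "HOL-Analysis.Analysis"
begin

section \<open>Hermitian matrices and states\<close>

definition mat_adjoint :: "complex^'n^'m \<Rightarrow> complex^'m^'n" where
  "mat_adjoint A = (\<chi> i j. cnj (A $ j $ i))"

definition hermitian :: "complex^'n^'n \<Rightarrow> bool" where
  "hermitian A \<longleftrightarrow> mat_adjoint A = A"

definition psd :: "complex^'n^'n \<Rightarrow> bool" where
  "psd A \<longleftrightarrow> hermitian A \<and> (\<forall>v. 0 \<le> Re (\<Sum>i\<in>UNIV. cnj (v $ i) * (A *v v) $ i))"

definition states :: "(complex^'n^'n) set" where
  "states = {\<rho>. psd \<rho> \<and> trace \<rho> = 1}"

text \<open>The trace of a product of two Hermitian matrices is real, so \<open>Re\<close> discards nothing.
  The same applies to the traces under \<open>Re\<close> in the Gibbs families, the entropy and the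
  relative entropy below.\<close>

definition hs_prod :: "complex^'n^'n \<Rightarrow> complex^'n^'n \<Rightarrow> real" where
  "hs_prod a b = Re (trace (a ** b))"

text \<open>The power series is written out because \<open>*\<close> and \<open>^\<close> on the type of matrices
  are not matrix multiplication and matrix power.\<close>

definition mat_exp :: "complex^'n^'n \<Rightarrow> complex^'n^'n" where
  "mat_exp A = (\<Sum>n. ((\<lambda>X. A ** X) ^^ n) (mat 1) /\<^sub>R fact n)"

text \<open>Functional calculus: a Hermitian matrix is diagonalizable with real eigenvalues, hence
  the matrix that acts as \<open>f x\<close> on each eigenspace for an eigenvalue \<open>x\<close> is unique.\<close>

definition hermitian_fun :: "(real \<Rightarrow> real) \<Rightarrow> complex^'n^'n \<Rightarrow> complex^'n^'n" where
  "hermitian_fun f A =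
     (THE L. \<forall>x v. A *v v = complex_of_real x *s v \<longrightarrow> L *v v = complex_of_real (f x) *s v)"

text \<open>The logarithm of a positive semidefinite matrix is set to zero on its kernel. This is the
  convention \<open>0 log 0 = 0\<close> in the entropy. In the relative entropy the value on the kernel of the
  second argument plays no role when this kernel is contained in that of the first argument.\<close>

definition mat_log :: "complex^'n^'n \<Rightarrow> complex^'n^'n" where
  "mat_log = hermitian_fun (\<lambda>x. if x = 0 then 0 else ln x)"

section \<open>Entropy and divergence\<close>

definition vn_entropy :: "complex^'n^'n \<Rightarrow> real" where
  "vn_entropy \<rho> = - Re (trace (\<rho> ** mat_log \<rho>))"

definition mat_kernel :: "complex^'n^'n \<Rightarrow> (complex^'n) set" where
  "mat_kernel A = {v. A *v v = 0}"

definition rel_entropy :: "complex^'n^'n \<Rightarrow> complex^'n^'n \<Rightarrow> ereal" where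
  "rel_entropy \<rho> \<sigma> =
     (if mat_kernel \<sigma> \<subseteq> mat_kernel \<rho>
      then ereal (Re (trace (\<rho> ** (mat_log \<rho> - mat_log \<sigma>)))) else \<infinity>)"

definition divergence_from :: "(complex^'n^'n) set \<Rightarrow> complex^'n^'n \<Rightarrow> ereal" where
  "divergence_from X \<rho> = (INF \<sigma>\<in>X. rel_entropy \<rho> \<sigma>)"

definition gibbs_family :: "(complex^'n^'n) set \<Rightarrow> (complex^'n^'n) set" where
  "gibbs_family \<H> = {mat_exp H /\<^sub>R Re (trace (mat_exp H)) | H. H \<in> \<H>}"

section \<open>The projection to the extended Gibbs family\<close>

text \<open>A subspace of Hermitian matrices enters through a basis \<open>B\<close>, indexed by a finite type:
  the subspace is \<open>span (range B)\<close> (span over the reals).\<close>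

definition basis_of :: "('r::finite \<Rightarrow> complex^'n^'n) \<Rightarrow> (complex^'n^'n) set \<Rightarrow> bool" where
  "basis_of B \<H> \<longleftrightarrow> inj B \<and> independent (range B) \<and> span (range B) = \<H>"

definition expect :: "('r::finite \<Rightarrow> complex^'n^'n) \<Rightarrow> complex^'n^'n \<Rightarrow> real^'r" where
  "expect B a = (\<chi> i. hs_prod (B i) a)"

definition convex_support :: "('r::finite \<Rightarrow> complex^'n^'n) \<Rightarrow> (real^'r) set" where
  "convex_support B = expect B ` states"

definition mat_projection :: "complex^'n^'n \<Rightarrow> bool" where
  "mat_projection p \<longleftrightarrow> p ** p = p \<and> hermitian p"

definition corner_states :: "complex^'n^'n \<Rightarrow> (complex^'n^'n) set" where
  "corner_states p = states \<inter> {p ** a ** p | a. True}"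

definition corner_gibbs_family ::
    "(complex^'n^'n) set \<Rightarrow> complex^'n^'n \<Rightarrow> (complex^'n^'n) set" where
  "corner_gibbs_family \<H> p =
     {(p ** mat_exp (p ** H ** p)) /\<^sub>R Re (trace (p ** mat_exp (p ** H ** p))) | H. H \<in> \<H>}"

definition face_projections :: "('r::finite \<Rightarrow> complex^'n^'n) \<Rightarrow> (complex^'n^'n) set" where
  "face_projections B =
     {p. mat_projection p \<and> p \<noteq> 0 \<and>
         (\<exists>F. F face_of convex_support B \<and> F \<noteq> {} \<and>
              corner_states p = {\<rho> \<in> states. expect B \<rho> \<in> F})}"

definition ext_gibbs_family :: "('r::finite \<Rightarrow> complex^'n^'n) \<Rightarrow> (complex^'n^'n) set" where
  "ext_gibbs_family B = (\<Union>p\<in>face_projections B. corner_gibbs_family (span (range B)) p)"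

definition gibbs_projection ::
    "('r::finite \<Rightarrow> complex^'n^'n) \<Rightarrow> complex^'n^'n \<Rightarrow> complex^'n^'n" where
  "gibbs_projection B \<rho> = (THE \<tau>. \<tau> \<in> ext_gibbs_family B \<and> expect B \<tau> = expect B \<rho>)"

section \<open>Three qubits\<close>

text \<open>The elements of the type \<open>3\<close> are the three sites. The standard basis vectors of the
  three-fold tensor product of \<open>\<complex>\<^sup>2\<close> are indexed by the eight configurations in \<open>3 \<Rightarrow> 2\<close>,
  so that operators on the tensor product are matrices indexed by configurations.\<close>

type_synonym three_qubit_op = "complex^(3 \<Rightarrow> 2)^(3 \<Rightarrow> 2)"

text \<open>An operator on the sites in \<open>A\<close> is a matrix \<open>b\<close> indexed by the configurations
  in \<open>A \<rightarrow>\<^sub>E UNIV\<close>; only its values there matter. \<open>amplify A b\<close> is the tensor product of \<open>b\<close> with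
  the identity on the complement of \<open>A\<close>.\<close>

definition amplify :: "3 set \<Rightarrow> ((3 \<Rightarrow> 2) \<Rightarrow> (3 \<Rightarrow> 2) \<Rightarrow> complex) \<Rightarrow> three_qubit_op" where
  "amplify A b =
     (\<chi> x y. if (\<forall>i. i \<notin> A \<longrightarrow> x i = y i) then b (restrict x A) (restrict y A) else 0)"

definition local_terms :: "nat \<Rightarrow> three_qubit_op set" where
  "local_terms k =
     {amplify A b | A b. card A \<le> k \<and>
        (\<forall>x \<in> A \<rightarrow>\<^sub>E UNIV. \<forall>y \<in> A \<rightarrow>\<^sub>E UNIV. b x y = cnj (b y x))}"

definition local_hamiltonians :: "nat \<Rightarrow> three_qubit_op set" where
  "local_hamiltonians k = {sum_list hs | hs. set hs \<subseteq> local_terms k}"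

text \<open>\<open>B2\<close> and \<open>B3\<close> stand for bases of the spaces of 2-local and 3-local Hamiltonians.\<close>

definition irreducible_correlation3 ::
    "('r::finite \<Rightarrow> three_qubit_op) \<Rightarrow> ('s::finite \<Rightarrow> three_qubit_op) \<Rightarrow> three_qubit_op \<Rightarrow> real" where
  "irreducible_correlation3 B2 B3 \<rho> =
     vn_entropy (gibbs_projection B2 \<rho>) - vn_entropy (gibbs_projection B3 \<rho>)"

end

(* Write S for the von Neumann entropy and E for the expectation map of a subspace H of Hermitian
   matrices. The Gibbs variational principle says that S(s) + <s,H> over the states s of a corner
   p M p is maximal exactly at the Gibbs state of pHp. Consequently S is an infimum of continuous
   affine functions, its hypograph over the (compact) state space is compact and convex, and every
   state of the extended Gibbs family is the only entropy maximizer in its fibre of E. Conversely, a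
   supporting hyperplane of the hypograph, pushed forward by E and restricted to the smallest face
   that contains E(rho), exhibits the entropy maximizer as a Gibbs state of the corner of that face.
   Strict separation from the same convex body gives inf_H (ln tr e^H - <rho,H>) = S(pi(rho)), which
   is the formula for the divergence.

   The discontinuity occurs at the GHZ state |000> + |111>. The states |000> + |111> and
   |000> - |111> have the same two-qubit marginals, so the maximum entropy is positive there,
   whereas |000> + |111> + t|110> with t nonzero is determined by its two-qubit marginals, so that
   C_3 vanishes on a sequence that converges to the GHZ state. *)

theory Submission
  imports Defs
begin


section \<open>Spectral calculus\<close>

text \<open>The projection to the extended Gibbs family is a definite description over a union of
  families, one per corner, so both existence and uniqueness have to be earned. Working with
  arbitrary corners is forced: entropy maximizers may have a kernel, and such a maximizer is no
  Gibbs state of the full algebra. For the same reason the infimum that defines the divergence need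
  not be attained, and the dual bound carries a slack \<open>d\<close>. In the example, |110> agrees
  with |111> on the sites 1 and 2. The coherence between |000> and |110> therefore survives when
  site 3 is traced out, and positivity ties to it the coherence between |000> and |111>, which no
  two-qubit marginal sees. Any nonzero amplitude of |110> suffices for this, so the perturbation can
  shrink to zero. The value of the correlation at the limit is never computed: two distinct states
  of entropy zero in one fibre already exclude that it vanishes.\<close>

definition cip :: "complex^'n \<Rightarrow> complex^'n \<Rightarrow> complex" where
  "cip x y = (\<Sum>i\<in>UNIV. cnj (x $ i) * y $ i)"

lemma cip_add_right: "cip x (y + z) = cip x y + cip x z"
  by (simp add: cip_def algebra_simps sum.distrib)

lemma cip_diff_right: "cip x (y - z) = cip x y - cip x z"
  by (simp add: cip_def algebra_simps sum_subtractf)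

lemma cip_smult_right: "cip x (c *s y) = c * cip x y"
  by (simp add: cip_def algebra_simps sum_distrib_left)

lemma cip_smult_left: "cip (c *s x) y = cnj c * cip x y"
  by (simp add: cip_def algebra_simps sum_distrib_left)

lemma cip_zero [simp]: "cip x 0 = 0" "cip 0 x = 0"
  by (simp_all add: cip_def)

lemma cip_sum_right: "cip x (sum f S) = (\<Sum>s\<in>S. cip x (f s))"
  by (induction S rule: infinite_finite_induct) (auto simp: cip_add_right)

lemma cnj_cip: "cnj (cip x y) = cip y x"
  by (simp add: cip_def mult.commute)

text \<open>Bridge to the real Euclidean structure of \<open>complex^'n\<close>, in which
  compactness, orthogonal complements and first-order optimality are available.\<close>

lemma Re_cip: "Re (cip x y) = x \<bullet> y"
  by (simp add: cip_def inner_vec_def inner_complex_def)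

lemma cip_self: "cip x x = of_real ((norm x)\<^sup>2)"
proof -
  have "Im (cip x x) = 0"
    using cnj_cip[of x x] by (metis Reals_cnj_iff complex_is_Real_iff)
  then show ?thesis
    by (simp add: complex_eq_iff Re_cip power2_norm_eq_inner)
qed

lemma cip_adjoint: "cip x (A *v y) = cip (mat_adjoint A *v x) y"
proof -
  have "cip x (A *v y) = (\<Sum>i\<in>UNIV. \<Sum>j\<in>UNIV. cnj (x $ i) * A $ i $ j * y $ j)"
    by (simp add: cip_def matrix_vector_mult_def sum_distrib_left mult.assoc)
  also have "\<dots> = (\<Sum>j\<in>UNIV. \<Sum>i\<in>UNIV. cnj (x $ i) * A $ i $ j * y $ j)"
    by (rule sum.swap)
  also have "\<dots> = cip (mat_adjoint A *v x) y"
    by (simp add: cip_def matrix_vector_mult_def mat_adjoint_def sum_distrib_right sum_distrib_left mult_ac)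
  finally show ?thesis .
qed

section \<open>Adjoints and the real space of Hermitian matrices\<close>

lemma hermitian_cip: "hermitian A \<Longrightarrow> cip x (A *v y) = cip (A *v x) y"
  by (simp add: cip_adjoint hermitian_def)

lemma mat_adjoint_mult: "mat_adjoint (A ** B) = mat_adjoint B ** mat_adjoint A"
  by (simp add: vec_eq_iff mat_adjoint_def matrix_matrix_mult_def mult.commute)

lemma hermitian_nth: "hermitian A \<Longrightarrow> A $ i $ j = cnj (A $ j $ i)"
  unfolding hermitian_def mat_adjoint_def by (metis vec_lambda_beta)

lemma hermitianI:
  assumes "\<And>i j. A $ i $ j = cnj (A $ j $ i)"
  shows "hermitian A"
  unfolding hermitian_def mat_adjoint_def vec_eq_iff vec_lambda_beta
  using assms[symmetric] by (intro allI)

lemma hermitian_add: "hermitian A \<Longrightarrow> hermitian B \<Longrightarrow> hermitian (A + B)"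
  by (simp add: hermitian_def mat_adjoint_def vec_eq_iff)

lemma hermitian_diff: "hermitian A \<Longrightarrow> hermitian B \<Longrightarrow> hermitian (A - B)"
  by (simp add: hermitian_def mat_adjoint_def vec_eq_iff)

lemma hermitian_scaleR: "hermitian A \<Longrightarrow> hermitian (r *\<^sub>R A)"
  by (simp add: hermitian_def mat_adjoint_def vec_eq_iff)

lemma hermitian_0: "hermitian 0"
  by (simp add: hermitian_def mat_adjoint_def vec_eq_iff)

lemma hermitian_mat_1: "hermitian (mat 1)"
  by (simp add: hermitian_def mat_adjoint_def vec_eq_iff mat_def)

lemma hermitian_sandwich:
  assumes "hermitian p" "hermitian H"
  shows "hermitian (p ** H ** p)"
  using assms by (simp add: hermitian_def mat_adjoint_mult matrix_mul_assoc)

lemma subspace_hermitian: "subspace {A. hermitian A}"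
  by (simp add: subspace_def hermitian_0 hermitian_add hermitian_scaleR)

lemma scaleR_conv_vector_scalar: "r *\<^sub>R (v::complex^'n) = of_real r *s v"
  by (simp add: vec_eq_iff scaleR_conv_of_real[where 'a=complex])

lemma linear_mult_vec: "linear ((*v) (A::complex^'n^'m))"
  by (intro linearI) (simp_all add: matrix_vector_right_distrib scaleR_conv_vector_scalar vec.scale)

section \<open>Orthonormal bases\<close>

definition orthonormal :: "('n::finite \<Rightarrow> complex^'n) \<Rightarrow> bool" where
  "orthonormal e \<longleftrightarrow> (\<forall>i j. cip (e i) (e j) = (if i = j then 1 else 0))"

text \<open>A family indexed by the coordinate type has the right number of vectors: as columns it
  forms a square matrix \<open>U\<close>, whose left inverse is also a right inverse.\<close>

lemma orthonormal_complete:
  assumes "orthonormal (e :: 'n::finite \<Rightarrow> complex^'n)"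
  shows "(\<Sum>j\<in>UNIV. e j $ r * cnj (e j $ c)) = (if r = c then 1 else 0)"
proof -
  define U :: "complex^'n^'n" where "U = (\<chi> r j. e j $ r)"
  have "mat_adjoint U ** U = mat 1"
    using assms
    by (simp add: vec_eq_iff matrix_matrix_mult_def mat_adjoint_def U_def mat_def orthonormal_def cip_def)
  then have "U ** mat_adjoint U = mat 1"
    using matrix_left_right_inverse by blast
  then have "(U ** mat_adjoint U) $ r $ c = mat 1 $ r $ c"
    by (simp only:)
  then show ?thesis
    by (simp add: matrix_matrix_mult_def mat_adjoint_def U_def mat_def)
qed

lemma orthonormal_expansion:
  assumes "orthonormal e"
  shows "(\<Sum>j\<in>UNIV. cip (e j) v *s e j) = v"
proof -
  have "(\<Sum>j\<in>UNIV. cip (e j) v *s e j) $ r = v $ r" for r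
  proof -
    have "(\<Sum>j\<in>UNIV. cip (e j) v *s e j) $ r
        = (\<Sum>j\<in>UNIV. \<Sum>c\<in>UNIV. e j $ r * cnj (e j $ c) * v $ c)"
      by (simp add: cip_def sum_distrib_right sum_distrib_left mult_ac)
    also have "\<dots> = (\<Sum>c\<in>UNIV. \<Sum>j\<in>UNIV. e j $ r * cnj (e j $ c) * v $ c)"
      by (rule sum.swap)
    also have "\<dots> = (\<Sum>c\<in>UNIV. (if r = c then 1 else 0) * v $ c)"
      by (simp only: sum_distrib_right[symmetric] orthonormal_complete[OF assms])
    also have "\<dots> = v $ r"
      by (simp add: if_distrib[of "\<lambda>x. x * _"] cong: if_cong)
    finally show ?thesis .
  qed
  then show ?thesis by (simp add: vec_eq_iff)
qed

lemma orthonormal_parseval: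
  assumes "orthonormal e"
  shows "(\<Sum>j\<in>UNIV. (cmod (cip (e j) v))\<^sup>2) = (norm v)\<^sup>2"
proof -
  have "of_real ((norm v)\<^sup>2) = cip v (\<Sum>j\<in>UNIV. cip (e j) v *s e j)"
    by (simp add: orthonormal_expansion[OF assms] cip_self)
  also have "\<dots> = (\<Sum>j\<in>UNIV. cip (e j) v * cnj (cip (e j) v))"
    by (simp add: cip_sum_right cip_smult_right cnj_cip)
  also have "\<dots> = of_real (\<Sum>j\<in>UNIV. (cmod (cip (e j) v))\<^sup>2)"
    by (simp add: complex_norm_square del: of_real_power)
  finally show ?thesis by (simp only: of_real_eq_iff)
qed

lemma orthonormal_norm:
  assumes "orthonormal e"
  shows "norm (e j) = 1"
proof -
  have "complex_of_real ((norm (e j))\<^sup>2) = of_real 1"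
    using assms cip_self[of "e j"] by (simp add: orthonormal_def)
  then have "(norm (e j))\<^sup>2 = 1" by (simp only: of_real_eq_iff)
  then show ?thesis using power2_eq_iff_nonneg[of "norm (e j)" 1] by simp
qed

lemma orthonormal_ext:
  assumes "orthonormal e" "\<And>j. A *v e j = B *v e j"
  shows "A = B"
proof -
  have "A *v v = B *v v" for v
  proof -
    have "A *v (\<Sum>j\<in>UNIV. cip (e j) v *s e j) = B *v (\<Sum>j\<in>UNIV. cip (e j) v *s e j)"
      by (simp only: linear_sum[OF linear_mult_vec] vec.scale assms(2))
    then show ?thesis
      by (simp add: orthonormal_expansion[OF assms(1)])
  qed
  then show ?thesis by (simp add: matrix_eq)
qed

section \<open>Matrices diagonal in an orthonormal basis, and functional calculus\<close>

definition spec_mat :: "('n::finite \<Rightarrow> complex^'n) \<Rightarrow> ('n \<Rightarrow> real) \<Rightarrow> complex^'n^'n" where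
  "spec_mat e a = (\<chi> r c. \<Sum>j\<in>UNIV. of_real (a j) * (e j $ r * cnj (e j $ c)))"

lemma spec_mat_vec: "spec_mat e a *v v = (\<Sum>j\<in>UNIV. (of_real (a j) * cip (e j) v) *s e j)"
proof -
  have "(spec_mat e a *v v) $ r = (\<Sum>j\<in>UNIV. (of_real (a j) * cip (e j) v) *s e j) $ r" for r
  proof -
    have "(spec_mat e a *v v) $ r
        = (\<Sum>c\<in>UNIV. \<Sum>j\<in>UNIV. of_real (a j) * (e j $ r * cnj (e j $ c)) * v $ c)"
      by (simp add: spec_mat_def matrix_vector_mult_def sum_distrib_right)
    also have "\<dots> = (\<Sum>j\<in>UNIV. \<Sum>c\<in>UNIV. of_real (a j) * (e j $ r * cnj (e j $ c)) * v $ c)"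
      by (rule sum.swap)
    also have "\<dots> = (\<Sum>j\<in>UNIV. (of_real (a j) * cip (e j) v) *s e j) $ r"
      by (simp add: cip_def sum_distrib_right sum_distrib_left mult_ac)
    finally show ?thesis .
  qed
  then show ?thesis by (simp add: vec_eq_iff)
qed

lemma spec_mat_eigen:
  assumes "orthonormal e"
  shows "spec_mat e a *v e j = of_real (a j) *s e j"
proof -
  have "spec_mat e a *v e j = (\<Sum>i\<in>UNIV. if i = j then of_real (a j) *s e j else 0)"
    unfolding spec_mat_vec using assms
    by (intro sum.cong refl) (auto simp: orthonormal_def)
  then show ?thesis by simp
qed

lemma spec_mat_eqI:
  assumes "orthonormal e" "\<And>j. A *v e j = of_real (a j) *s e j"
  shows "A = spec_mat e a"
  by (rule orthonormal_ext[OF assms(1)]) (simp only: assms(2) spec_mat_eigen[OF assms(1)])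

lemma spec_mat_one: "orthonormal e \<Longrightarrow> spec_mat e (\<lambda>_. 1) = mat 1"
  by (rule spec_mat_eqI[symmetric]) auto

lemma spec_mat_mult:
  assumes "orthonormal e"
  shows "spec_mat e a ** spec_mat e b = spec_mat e (\<lambda>j. a j * b j)"
  by (rule spec_mat_eqI[OF assms])
    (simp add: matrix_vector_mul_assoc[symmetric] spec_mat_eigen[OF assms] vec.scale mult.commute)

lemma spec_mat_scaleR: "spec_mat e (\<lambda>j. r * a j) = r *\<^sub>R spec_mat e a"
  by (simp add: vec_eq_iff spec_mat_def scaleR_conv_of_real[where 'a=complex] sum_distrib_left mult_ac)

lemma spec_mat_diff: "spec_mat e (\<lambda>j. a j - b j) = spec_mat e a - spec_mat e b"
  by (simp add: vec_eq_iff spec_mat_def algebra_simps sum_subtractf)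

lemma hermitian_spec_mat: "hermitian (spec_mat e a)"
  by (rule hermitianI) (simp add: spec_mat_def mult_ac)

lemma spec_mat_sum: "spec_mat e a = (\<Sum>j\<in>UNIV. a j *\<^sub>R (\<chi> r c. e j $ r * cnj (e j $ c)))"
  by (simp add: vec_eq_iff spec_mat_def scaleR_conv_of_real[where 'a=complex])

lemma cip_spec_mat:
  "cip v (spec_mat e a *v v) = of_real (\<Sum>j\<in>UNIV. a j * (cmod (cip (e j) v))\<^sup>2)"
proof -
  have "cip v (spec_mat e a *v v) = (\<Sum>j\<in>UNIV. of_real (a j) * (cip (e j) v * cnj (cip (e j) v)))"
    by (simp add: spec_mat_vec cip_sum_right cip_smult_right cnj_cip mult.assoc)
  also have "\<dots> = of_real (\<Sum>j\<in>UNIV. a j * (cmod (cip (e j) v))\<^sup>2)"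
    by (simp add: complex_norm_square del: of_real_power)
  finally show ?thesis .
qed

lemma psd_spec_mat_iff:
  assumes "orthonormal e"
  shows "psd (spec_mat e a) \<longleftrightarrow> (\<forall>j. 0 \<le> a j)"
proof
  assume "psd (spec_mat e a)"
  then have "0 \<le> Re (cip v (spec_mat e a *v v))" for v
    by (simp add: psd_def cip_def)
  from this[of "e _"] show "\<forall>j. 0 \<le> a j"
    using assms by (simp add: spec_mat_eigen cip_smult_right orthonormal_def)
next
  assume "\<forall>j. 0 \<le> a j"
  then have "0 \<le> Re (cip v (spec_mat e a *v v))" for v
    by (simp add: cip_spec_mat sum_nonneg)
  then show "psd (spec_mat e a)"
    by (simp add: psd_def cip_def hermitian_spec_mat)
qed

lemma trace_mult_commute: "trace (A ** B) = trace (B ** (A::complex^'n^'n))"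
proof -
  have "trace (A ** B) = (\<Sum>i\<in>UNIV. \<Sum>j\<in>UNIV. A $ i $ j * B $ j $ i)"
    by (simp add: trace_def matrix_matrix_mult_def)
  also have "\<dots> = (\<Sum>j\<in>UNIV. \<Sum>i\<in>UNIV. A $ i $ j * B $ j $ i)"
    by (rule sum.swap)
  finally show ?thesis
    by (simp add: trace_def matrix_matrix_mult_def mult.commute)
qed

lemma trace_spec_mat_mult:
  "trace (spec_mat e a ** M) = (\<Sum>j\<in>UNIV. of_real (a j) * cip (e j) (M *v e j))"
proof -
  have "trace (spec_mat e a ** M)
      = (\<Sum>r\<in>UNIV. \<Sum>c\<in>UNIV. \<Sum>j\<in>UNIV. of_real (a j) * (e j $ r * cnj (e j $ c)) * M $ c $ r)"
    by (simp add: trace_def matrix_matrix_mult_def spec_mat_def sum_distrib_right)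
  also have "\<dots> = (\<Sum>r\<in>UNIV. \<Sum>j\<in>UNIV. \<Sum>c\<in>UNIV. of_real (a j) * (e j $ r * cnj (e j $ c)) * M $ c $ r)"
    by (intro sum.cong refl sum.swap)
  also have "\<dots> = (\<Sum>j\<in>UNIV. \<Sum>r\<in>UNIV. \<Sum>c\<in>UNIV. of_real (a j) * (e j $ r * cnj (e j $ c)) * M $ c $ r)"
    by (rule sum.swap)
  also have "\<dots> = (\<Sum>j\<in>UNIV. \<Sum>c\<in>UNIV. \<Sum>r\<in>UNIV. of_real (a j) * (e j $ r * cnj (e j $ c)) * M $ c $ r)"
    by (intro sum.cong refl sum.swap)
  also have "\<dots> = (\<Sum>j\<in>UNIV. of_real (a j) * cip (e j) (M *v e j))"
    by (simp add: cip_def matrix_vector_mult_def sum_distrib_left mult_ac)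
  finally show ?thesis .
qed

lemma trace_spec_mat:
  assumes "orthonormal e"
  shows "trace (spec_mat e a) = of_real (\<Sum>j\<in>UNIV. a j)"
  using trace_spec_mat_mult[of e a "mat 1"] assms by (simp add: orthonormal_def)

text \<open>Eigenvalues may repeat, so an eigenvector need not be one of the \<open>e j\<close>. Its
  components vanish wherever \<open>a j\<close> differs from its eigenvalue, so the right-hand side
  still acts on it as one scalar. Uniqueness holds because the basis vectors alone determine a
  matrix.\<close>

lemma hermitian_fun_spec_mat:
  assumes e: "orthonormal e"
  shows "hermitian_fun f (spec_mat e a) = spec_mat e (\<lambda>j. f (a j))"
  unfolding hermitian_fun_def
proof (rule the_equality)
  show "\<forall>x v. spec_mat e a *v v = of_real x *s v
      \<longrightarrow> spec_mat e (\<lambda>j. f (a j)) *v v = of_real (f x) *s v"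
  proof (intro allI impI)
    fix x v
    assume ev: "spec_mat e a *v v = of_real x *s v"
    have "of_real (a j) * cip (e j) v = of_real x * cip (e j) v" for j
    proof -
      have "cip (e j) (spec_mat e a *v v) = cip (spec_mat e a *v e j) v"
        by (simp add: hermitian_cip hermitian_spec_mat)
      then show ?thesis
        by (auto simp: ev cip_smult_right spec_mat_eigen[OF e] cip_smult_left)
    qed
    then have *: "of_real (f (a j)) * cip (e j) v = of_real (f x) * cip (e j) v" for j
      by (metis mult_cancel_right of_real_eq_iff)
    have "spec_mat e (\<lambda>j. f (a j)) *v v = (\<Sum>j\<in>UNIV. (of_real (f x) * cip (e j) v) *s e j)"
      by (simp only: spec_mat_vec *)
    also have "\<dots> = of_real (f x) *s (\<Sum>j\<in>UNIV. cip (e j) v *s e j)"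
      by (simp add: vec_eq_iff sum_distrib_left mult.assoc)
    finally show "spec_mat e (\<lambda>j. f (a j)) *v v = of_real (f x) *s v"
      by (simp add: orthonormal_expansion[OF e])
  qed
next
  fix L
  assume "\<forall>x v. spec_mat e a *v v = of_real x *s v \<longrightarrow> L *v v = of_real (f x) *s v"
  then show "L = spec_mat e (\<lambda>j. f (a j))"
    by (intro spec_mat_eqI[OF e]) (simp add: spec_mat_eigen[OF e])
qed

text \<open>The case distinction in \<open>mat_log\<close> disappears because the total logarithm
  satisfies \<open>ln 0 = 0\<close>.\<close>

lemma mat_log_spec_mat:
  "orthonormal e \<Longrightarrow> mat_log (spec_mat e a) = spec_mat e (\<lambda>j. ln (a j))"
  by (simp add: mat_log_def hermitian_fun_spec_mat, rule arg_cong[of _ _ "spec_mat e"]) auto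

text \<open>Powers act on the eigenvalues, and \<open>spec_mat\<close> is a finite combination of
  fixed rank-one matrices, so the matrix series reduces to finitely many scalar ones.\<close>

lemma mat_exp_spec_mat:
  assumes e: "orthonormal e"
  shows "mat_exp (spec_mat e a) = spec_mat e (\<lambda>j. exp (a j))"
proof -
  have pow: "((\<lambda>X. spec_mat e a ** X) ^^ n) (mat 1) = spec_mat e (\<lambda>j. a j ^ n)" for n
    by (induction n) (simp_all add: spec_mat_one[OF e] spec_mat_mult[OF e])
  have "(\<lambda>n. \<Sum>j\<in>UNIV. (a j ^ n /\<^sub>R fact n) *\<^sub>R (\<chi> r c. e j $ r * cnj (e j $ c)))
      sums (\<Sum>j\<in>UNIV. exp (a j) *\<^sub>R (\<chi> r c. e j $ r * cnj (e j $ c)))"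
    by (intro sums_sum sums_scaleR_left exp_converges)
  moreover have "(\<Sum>j\<in>UNIV. (a j ^ n /\<^sub>R fact n) *\<^sub>R (\<chi> r c. e j $ r * cnj (e j $ c)))
      = ((\<lambda>X. spec_mat e a ** X) ^^ n) (mat 1) /\<^sub>R fact n" for n
    by (simp only: pow spec_mat_sum[of e "\<lambda>j. a j ^ n"] scaleR_right.sum scaleR_scaleR real_scaleR_def)
  ultimately have "(\<lambda>n. ((\<lambda>X. spec_mat e a ** X) ^^ n) (mat 1) /\<^sub>R fact n)
      sums spec_mat e (\<lambda>j. exp (a j))"
    unfolding spec_mat_sum[of e "\<lambda>j. exp (a j)"] by simp
  then show ?thesis
    unfolding mat_exp_def by (rule sums_unique[symmetric])
qed

subsection \<open>Simultaneous diagonalization\<close>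

text \<open>Rayleigh quotient: a maximizer of the quadratic form on the unit sphere of
  \<open>W\<close> is an eigenvector. Invariance of \<open>W\<close> keeps the residual
  \<open>z\<close> inside \<open>W\<close>, so that it is an admissible direction of
  variation.\<close>

lemma hermitian_eigenvector_exists:
  fixes A :: "complex^'n^'n"
  assumes A: "hermitian A" and W: "subspace W" and inv: "\<And>v. v \<in> W \<Longrightarrow> A *v v \<in> W"
    and ne: "u \<in> W" "u \<noteq> 0"
  shows "\<exists>v x. v \<in> W \<and> norm v = 1 \<and> A *v v = complex_of_real x *s v"
proof -
  have lin: "linear ((*v) A)" by (rule linear_mult_vec)
  have sym: "x \<bullet> (A *v y) = (A *v x) \<bullet> y" for x y
    using hermitian_cip[OF A, of x y] by (simp add: Re_cip[symmetric])
  let ?S = "W \<inter> sphere 0 1"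
  have "compact ?S"
    by (simp add: W closed_subspace closed_Int_compact)
  moreover have "u /\<^sub>R norm u \<in> ?S"
    using ne W by (simp add: subspace_scale)
  moreover have "continuous_on ?S (\<lambda>v. v \<bullet> (A *v v))"
    by (intro continuous_intros linear_continuous_on linear_conv_bounded_linear[THEN iffD1] lin)
  ultimately obtain v where v: "v \<in> ?S" and max: "\<And>w. w \<in> ?S \<Longrightarrow> w \<bullet> (A *v w) \<le> v \<bullet> (A *v v)"
    using continuous_attains_sup[of ?S "\<lambda>v. v \<bullet> (A *v v)"] by blast
  define l where "l = v \<bullet> (A *v v)"
  have q: "w \<bullet> (A *v w) \<le> l * (w \<bullet> w)" if "w \<in> W" for w
  proof (cases "w = 0")
    case False
    have "w /\<^sub>R norm w \<in> ?S"
      using that W False by (simp add: subspace_scale)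
    from max[OF this] have "(w \<bullet> (A *v w)) / (norm w)\<^sup>2 \<le> l"
      by (simp add: l_def linear_scale[OF lin] power2_eq_square field_simps)
    then show ?thesis
      using False by (simp add: field_simps dot_square_norm)
  qed simp
  define z where "z = A *v v - l *\<^sub>R v"
  have zW: "z \<in> W"
    using v W inv by (simp add: z_def subspace_diff subspace_scale)
  have vv: "v \<bullet> v = 1" using v by (simp add: dot_square_norm)
  \<comment> \<open>First-order optimality at \<open>v\<close> in the direction \<open>z\<close> of the residual.\<close>
  have "2 * t * (z \<bullet> z) \<le> t\<^sup>2 * (l * (z \<bullet> z) - z \<bullet> (A *v z))" for t :: real
  proof -
    have "v + t *\<^sub>R z \<in> W"
      using v W zW by (simp add: subspace_add subspace_scale)
    from q[OF this] have "(v + t *\<^sub>R z) \<bullet> (A *v (v + t *\<^sub>R z)) \<le> l * ((v + t *\<^sub>R z) \<bullet> (v + t *\<^sub>R z))" .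
    moreover have zAv: "z \<bullet> (A *v v) = z \<bullet> z + l * (z \<bullet> v)"
      by (simp add: z_def inner_diff_right inner_diff_left)
    have vAz: "v \<bullet> (A *v z) = z \<bullet> z + l * (z \<bullet> v)"
      unfolding zAv[symmetric] sym[of v z] by (rule inner_commute)
    have "(v + t *\<^sub>R z) \<bullet> (A *v (v + t *\<^sub>R z)) = l + 2 * t * (z \<bullet> z + l * (z \<bullet> v)) + t\<^sup>2 * (z \<bullet> (A *v z))"
      unfolding linear_add[OF lin] linear_scale[OF lin] inner_add_left inner_add_right
        inner_scaleR_left inner_scaleR_right zAv vAz l_def[symmetric] power2_eq_square
      by (simp only: algebra_simps mult_2)
    moreover have "(v + t *\<^sub>R z) \<bullet> (v + t *\<^sub>R z) = 1 + 2 * t * (z \<bullet> v) + t\<^sup>2 * (z \<bullet> z)"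
      unfolding inner_add_left inner_add_right inner_scaleR_left inner_scaleR_right
        inner_commute[of v z] vv power2_eq_square
      by (simp only: algebra_simps mult_2)
    ultimately show ?thesis
      by (simp only:) (simp add: algebra_simps)
  qed
  note opt = this
  have "z \<bullet> z = 0"
  proof (rule ccontr)
    assume "z \<bullet> z \<noteq> 0"
    then have pos: "z \<bullet> z > 0" by simp
    \<comment> \<open>The summand 1 keeps \<open>c\<close> positive. The step size \<open>t\<close>
      makes the quadratic bound equal to \<open>t * (z \<bullet> z)\<close>, only half of the linear
      term.\<close>
    define c where "c = \<bar>l * (z \<bullet> z) - z \<bullet> (A *v z)\<bar> + 1"
    define t where "t = (z \<bullet> z) / c"
    have c: "c > 0" by (simp add: c_def)
    then have t: "t > 0" using pos by (simp add: t_def)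
    have "2 * t * (z \<bullet> z) \<le> t\<^sup>2 * c"
      by (rule order_trans[OF opt]) (auto intro!: mult_left_mono simp: c_def)
    also have "\<dots> = t * (z \<bullet> z)"
      using c by (simp add: t_def power2_eq_square)
    finally show False using t pos by simp
  qed
  then have "A *v v = l *\<^sub>R v" by (simp add: z_def)
  then show ?thesis
    using v by (auto simp: scaleR_conv_vector_scalar)
qed

text \<open>Commutation makes the eigenspace of \<open>B\<close> inside \<open>W\<close> invariant
  under \<open>A\<close>, so an eigenvector of \<open>A\<close> can be sought there.\<close>

lemma common_eigenvector_exists:
  fixes A B :: "complex^'n^'n"
  assumes A: "hermitian A" and B: "hermitian B" and comm: "A ** B = B ** A"
    and W: "subspace W" and invA: "\<And>v. v \<in> W \<Longrightarrow> A *v v \<in> W" and invB: "\<And>v. v \<in> W \<Longrightarrow> B *v v \<in> W"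
    and ne: "u \<in> W" "u \<noteq> 0"
  shows "\<exists>v x y. v \<in> W \<and> norm v = 1 \<and> A *v v = complex_of_real x *s v \<and> B *v v = complex_of_real y *s v"
proof -
  obtain w y where w: "w \<in> W" "norm w = 1" "B *v w = complex_of_real y *s w"
    using hermitian_eigenvector_exists[OF B W invB ne] by blast
  let ?V = "W \<inter> {v. B *v v - y *\<^sub>R v = 0}"
  have lin: "linear (\<lambda>v. B *v v - y *\<^sub>R v)"
    by (intro linear_compose_sub linear_mult_vec linear_scale_self)
  have V: "subspace ?V"
    by (intro subspace_inter W linear_subspace_kernel lin)
  have "A *v v \<in> ?V" if v: "v \<in> ?V" for v
  proof -
    have "B *v (A *v v) = A *v (B *v v)"
      by (simp add: matrix_vector_mul_assoc comm)
    also have "\<dots> = y *\<^sub>R (A *v v)"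
      using v linear_scale[OF linear_mult_vec[of A]] by simp
    finally show ?thesis using v invA by simp
  qed
  moreover have "w \<in> ?V" "w \<noteq> 0"
    using w by (auto simp: scaleR_conv_vector_scalar)
  ultimately obtain v x where "v \<in> ?V" "norm v = 1" "A *v v = complex_of_real x *s v"
    using hermitian_eigenvector_exists[OF A V] by blast
  then show ?thesis
    by (auto simp: scaleR_conv_vector_scalar)
qed

text \<open>Induction over the index set: the vectors orthogonal to those already found form a
  subspace invariant under both matrices.\<close>

lemma simultaneous_diagonalization:
  fixes A B :: "complex^'n^'n"
  assumes A: "hermitian A" and B: "hermitian B" and comm: "A ** B = B ** A"
  obtains e a b where "orthonormal e" "A = spec_mat e a" "B = spec_mat e b"
proof -
  have "\<exists>e a b. (\<forall>i\<in>S. \<forall>j\<in>S. cip (e i) (e j) = (if i = j then 1 else 0)) \<and>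
      (\<forall>j\<in>S. A *v e j = complex_of_real (a j) *s e j \<and> B *v e j = complex_of_real (b j) *s e j)"
    if "finite S" for S :: "'n set"
    using that
  proof (induction S)
    case empty
    then show ?case by simp
  next
    case (insert s S)
    then obtain e a b
      where on: "\<And>i j. i \<in> S \<Longrightarrow> j \<in> S \<Longrightarrow> cip (e i) (e j) = (if i = j then 1 else 0)"
      and eA: "\<And>j. j \<in> S \<Longrightarrow> A *v e j = complex_of_real (a j) *s e j"
      and eB: "\<And>j. j \<in> S \<Longrightarrow> B *v e j = complex_of_real (b j) *s e j"
      by blast
    let ?W = "{v. \<forall>j\<in>S. cip (e j) v = 0}"
    have W: "subspace ?W"
      by (simp add: subspace_def cip_add_right scaleR_conv_vector_scalar cip_smult_right)
    have invA: "A *v v \<in> ?W" if "v \<in> ?W" for v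
      using that eA by (simp add: hermitian_cip[OF A] cip_smult_left)
    have invB: "B *v v \<in> ?W" if "v \<in> ?W" for v
      using that eB by (simp add: hermitian_cip[OF B] cip_smult_left)
    \<comment> \<open>Complex orthogonality to \<open>e j\<close> is real orthogonality to
      \<open>e j\<close> and to \<open>\<i> *s e j\<close>. These are at most
      \<open>2 * card S\<close> real conditions, fewer than the real dimension of the space.\<close>
    let ?T = "e ` S \<union> (\<lambda>j. \<i> *s e j) ` S"
    have "dim ?T \<le> card ?T"
      using insert.hyps by (intro dim_le_card') auto
    also have "\<dots> \<le> card S + card S"
      using card_Un_le[of "e ` S" "(\<lambda>j. \<i> *s e j) ` S"] card_image_le[OF insert.hyps(1), of e]
        card_image_le[OF insert.hyps(1), of "\<lambda>j. \<i> *s e j"] by linarith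
    also have "\<dots> < DIM(complex^'n)"
    proof -
      have "card S < CARD('n)"
        using insert.hyps by (intro psubset_card_mono) auto
      then show ?thesis by simp
    qed
    finally obtain u where u: "u \<noteq> 0" "\<And>y. y \<in> span ?T \<Longrightarrow> orthogonal u y"
      using orthogonal_to_subspace_exists by blast
    have "cip (e j) u = 0" if j: "j \<in> S" for j
    proof -
      have "e j \<bullet> u = 0" "(\<i> *s e j) \<bullet> u = 0"
        using u(2)[OF span_base, of "e j"] u(2)[OF span_base, of "\<i> *s e j"] j
        by (auto simp: orthogonal_def inner_commute)
      then have "Re (cip (e j) u) = 0" "Im (cip (e j) u) = 0"
        by (simp_all add: Re_cip[symmetric] cip_smult_left)
      then show ?thesis by (simp add: complex_eq_iff)
    qed
    then have "u \<in> ?W" by simp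
    from common_eigenvector_exists[OF A B comm W invA invB this u(1)]
    obtain v x y where v: "v \<in> ?W" "norm v = 1" "A *v v = complex_of_real x *s v"
      "B *v v = complex_of_real y *s v" by blast
    have vv: "cip v v = 1" using v(2) by (simp add: cip_self)
    have ve: "cip v (e j) = 0" if "j \<in> S" for j
      using v(1) that cnj_cip[of "e j" v] by simp
    have "\<forall>i\<in>insert s S. \<forall>j\<in>insert s S. cip ((e(s := v)) i) ((e(s := v)) j) = (if i = j then 1 else 0)"
    proof (intro ballI)
      fix i j
      assume "i \<in> insert s S" "j \<in> insert s S"
      then show "cip ((e(s := v)) i) ((e(s := v)) j) = (if i = j then 1 else 0)"
        using on[of i j] ve[of j] v(1) vv by (cases "i = s"; cases "j = s") auto
    qed
    moreover have "\<forall>j\<in>insert s S. A *v (e(s := v)) j = complex_of_real ((a(s := x)) j) *s (e(s := v)) j \<and>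
        B *v (e(s := v)) j = complex_of_real ((b(s := y)) j) *s (e(s := v)) j"
      using eA eB v(3,4) by simp
    ultimately show ?case by blast
  qed
  from this[of UNIV] obtain e :: "'n \<Rightarrow> complex^'n" and a b where
    on: "\<forall>i j. cip (e i) (e j) = (if i = j then 1 else 0)"
    and ev: "\<forall>j. A *v e j = complex_of_real (a j) *s e j \<and> B *v e j = complex_of_real (b j) *s e j"
    by auto
  from on have "orthonormal e" by (simp add: orthonormal_def)
  then show ?thesis
    using ev by (intro that[of e a b] spec_mat_eqI) auto
qed

lemma hermitian_spectral:
  assumes "hermitian A"
  obtains e a where "orthonormal e" "A = spec_mat e a"
  using simultaneous_diagonalization[OF assms assms refl] by metis


section \<open>The Gibbs variational principle on a corner\<close>

lemma spec_mat_inject: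
  assumes "orthonormal e" "spec_mat e a = spec_mat e b"
  shows "a j = b j"
proof -
  have "cip (e j) (spec_mat e a *v e j) = cip (e j) (spec_mat e b *v e j)"
    by (simp only: assms(2))
  then show ?thesis
    using assms(1) by (simp add: spec_mat_eigen cip_smult_right orthonormal_def)
qed

lemma states_spectral:
  assumes "\<rho> \<in> states"
  obtains e a where "orthonormal e" "\<rho> = spec_mat e a" "\<And>j. 0 \<le> a j" "(\<Sum>j\<in>UNIV. a j) = 1"
proof -
  obtain e a where ea: "orthonormal e" "\<rho> = spec_mat e a"
    using assms hermitian_spectral[of \<rho>] by (auto simp: states_def psd_def)
  have "of_real (\<Sum>j\<in>UNIV. a j) = complex_of_real 1"
    using assms trace_spec_mat[OF ea(1), of a] by (simp add: states_def ea(2))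
  then have "(\<Sum>j\<in>UNIV. a j) = 1"
    by (simp only: of_real_eq_iff)
  then show ?thesis
    using assms ea psd_spec_mat_iff[OF ea(1), of a] by (intro that[of e a]) (auto simp: states_def)
qed

lemma spec_mat_in_states:
  assumes "orthonormal e" "\<And>j. 0 \<le> a j" "(\<Sum>j\<in>UNIV. a j) = 1"
  shows "spec_mat e a \<in> states"
  using assms by (simp add: states_def psd_spec_mat_iff trace_spec_mat)

lemma vn_entropy_spec_mat:
  "orthonormal e \<Longrightarrow> vn_entropy (spec_mat e a) = - (\<Sum>j\<in>UNIV. a j * ln (a j))"
  by (simp add: vn_entropy_def mat_log_spec_mat spec_mat_mult trace_spec_mat)

lemma vn_entropy_nonneg:
  assumes "\<rho> \<in> states"
  shows "0 \<le> vn_entropy \<rho>"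
proof -
  obtain e a where e: "orthonormal e" "\<rho> = spec_mat e a" and a: "\<And>j. 0 \<le> a j" "(\<Sum>j\<in>UNIV. a j) = 1"
    using states_spectral[OF assms] by blast
  have "a j \<le> 1" for j
    using member_le_sum[of j UNIV a] a by simp
  then have "a j * ln (a j) \<le> 0" for j
    using a(1)[of j] by (cases "a j = 0") (simp_all add: mult_nonneg_nonpos)
  then show ?thesis
    by (simp add: e vn_entropy_spec_mat sum_nonpos)
qed

lemma corner_states_iff:
  assumes "mat_projection p"
  shows "\<sigma> \<in> corner_states p \<longleftrightarrow> \<sigma> \<in> states \<and> p ** \<sigma> ** p = \<sigma>"
proof -
  have "p ** (p ** a ** p) ** p = p ** a ** p" for a
  proof -
    have "p ** (p ** a ** p) ** p = (p ** p) ** a ** (p ** p)"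
      by (simp only: matrix_mul_assoc)
    then show ?thesis using assms by (simp add: mat_projection_def)
  qed
  then show ?thesis
    unfolding corner_states_def by (auto, metis)
qed

text \<open>\<open>p ** H ** p\<close> absorbs \<open>p\<close> on both sides, hence commutes with
  it. Idempotence restricts the eigenvalues of \<open>p\<close> to 0 and 1, and absorption makes
  those of \<open>p ** H ** p\<close> vanish outside the corner.\<close>

lemma projection_corner_diagonalization:
  assumes p: "mat_projection p" and H: "hermitian H"
  obtains e k b where "orthonormal e" "p ** H ** p = spec_mat e k" "p = spec_mat e b"
    "\<And>j. b j = 0 \<or> b j = 1" "\<And>j. b j = 0 \<Longrightarrow> k j = 0"
proof -
  have pp: "p ** p = p" and hp: "hermitian p"
    using p by (auto simp: mat_projection_def)
  have l: "p ** (p ** H ** p) = p ** H ** p" and r: "(p ** H ** p) ** p = p ** H ** p"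
    by (simp_all only: matrix_mul_assoc pp) (simp only: matrix_mul_assoc[symmetric] pp)
  obtain e k b where e: "orthonormal e" and k: "p ** H ** p = spec_mat e k" and b: "p = spec_mat e b"
    using simultaneous_diagonalization[OF hermitian_sandwich[OF hp H] hp] l r by metis
  have "spec_mat e (\<lambda>j. b j * b j) = spec_mat e b"
    using pp by (simp add: b spec_mat_mult[OF e])
  from spec_mat_inject[OF e this] have bb: "b j * b j = b j" for j .
  have "spec_mat e (\<lambda>j. b j * k j) = spec_mat e k"
    using l by (simp only: k) (simp add: b spec_mat_mult[OF e])
  from spec_mat_inject[OF e this] have bk: "b j * k j = k j" for j .
  show ?thesis
    using e k b
  proof (rule that)
    show "b j = 0 \<or> b j = 1" for j using bb[of j] by simp
    show "k j = 0" if "b j = 0" for j using bk[of j] that by simp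
  qed
qed

text \<open>The left factor \<open>p\<close> discards the eigenvalues \<open>exp 0 = 1\<close> that
  the exponential has on the complement of the corner.\<close>

definition partition_fun :: "complex^'n^'n \<Rightarrow> complex^'n^'n \<Rightarrow> real" where
  "partition_fun p H = Re (trace (p ** mat_exp (p ** H ** p)))"

definition corner_gibbs :: "complex^'n^'n \<Rightarrow> complex^'n^'n \<Rightarrow> complex^'n^'n" where
  "corner_gibbs p H = (p ** mat_exp (p ** H ** p)) /\<^sub>R partition_fun p H"

lemma corner_gibbs_diagonal:
  assumes "orthonormal e" "p ** H ** p = spec_mat e k" "p = spec_mat e b"
  shows "partition_fun p H = (\<Sum>j\<in>UNIV. b j * exp (k j))"
    and "corner_gibbs p H = spec_mat e (\<lambda>j. b j * exp (k j) / partition_fun p H)"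
proof -
  have G: "p ** mat_exp (p ** H ** p) = spec_mat e (\<lambda>j. b j * exp (k j))"
    unfolding assms(2) mat_exp_spec_mat[OF assms(1)] by (simp add: assms(3) spec_mat_mult[OF assms(1)])
  show "partition_fun p H = (\<Sum>j\<in>UNIV. b j * exp (k j))"
    unfolding partition_fun_def G by (simp add: trace_spec_mat[OF assms(1)])
  show "corner_gibbs p H = spec_mat e (\<lambda>j. b j * exp (k j) / partition_fun p H)"
    unfolding corner_gibbs_def G by (simp add: spec_mat_scaleR[symmetric] divide_inverse mult.commute)
qed

lemma partition_fun_pos:
  assumes p: "mat_projection p" "p \<noteq> 0" and H: "hermitian H"
  shows "partition_fun p H > 0"
proof -
  obtain e k b where e: "orthonormal e" and k: "p ** H ** p = spec_mat e k" and b: "p = spec_mat e b"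
    and b01: "\<And>j. b j = 0 \<or> b j = 1"
    using projection_corner_diagonalization[OF p(1) H] by metis
  have "\<exists>j. b j \<noteq> 0"
  proof (rule ccontr)
    assume "\<nexists>j. b j \<noteq> 0"
    then have "p = 0" by (simp add: b spec_mat_def vec_eq_iff)
    then show False using p by simp
  qed
  then obtain j where j: "b j \<noteq> 0" by blast
  have "0 < (\<Sum>j\<in>UNIV. b j * exp (k j))"
  proof (rule sum_pos2[of _ j])
    show "0 < b j * exp (k j)" using j b01[of j] by auto
    show "0 \<le> b i * exp (k i)" for i using b01[of i] by auto
  qed auto
  then show ?thesis by (simp add: corner_gibbs_diagonal[OF e k b])
qed

text \<open>Scalar form of Klein's inequality: \<open>ln x \<le> x - 1\<close>, with equality only
  at 1, applied to \<open>t / s\<close>. For \<open>s = 0\<close> the expression is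
  \<open>t\<close>, since \<open>0 * ln 0 = 0\<close>.\<close>

lemma relative_entropy_term:
  fixes s t :: real
  assumes "0 \<le> s" "0 < t"
  shows "0 \<le> s * ln s - s * ln t - s + t"
    and "s * ln s - s * ln t - s + t = 0 \<Longrightarrow> s = t"
proof -
  have "0 \<le> s * ln s - s * ln t - s + t \<and> (s * ln s - s * ln t - s + t = 0 \<longrightarrow> s = t)"
  proof (cases "s = 0")
    case False
    then have s: "s > 0" using assms by simp
    have eq: "s * ln s - s * ln t - s + t = s * (t / s - 1 - ln (t / s))"
      using s assms by (simp add: ln_div field_simps)
    have "0 \<le> t / s - 1 - ln (t / s)"
      using s assms ln_le_minus_one[of "t / s"] by simp
    moreover have "s = t" if "t / s - 1 - ln (t / s) = 0"
      using s assms ln_eq_minus_one[of "t / s"] that by simp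
    ultimately show ?thesis using s by (simp add: eq)
  qed (use assms in auto)
  then show "0 \<le> s * ln s - s * ln t - s + t"
    and "s * ln s - s * ln t - s + t = 0 \<Longrightarrow> s = t" by auto
qed

lemma hs_prod_commute: "hs_prod a b = hs_prod b (a :: complex^'n^'n)"
  by (simp add: hs_prod_def trace_mult_commute)

lemma hs_prod_corner:
  assumes "p ** \<sigma> ** p = \<sigma>"
  shows "hs_prod H \<sigma> = hs_prod (p ** H ** p) \<sigma>"
proof -
  have "trace (H ** \<sigma>) = trace ((H ** p ** \<sigma>) ** p)"
    by (subst assms[symmetric]) (simp only: matrix_mul_assoc)
  also have "\<dots> = trace (p ** (H ** p ** \<sigma>))"
    by (rule trace_mult_commute)
  finally show ?thesis by (simp add: hs_prod_def matrix_mul_assoc)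
qed

lemma corner_gibbs_state:
  assumes p: "mat_projection p" "p \<noteq> 0" and H: "hermitian H"
  shows "corner_gibbs p H \<in> corner_states p"
    and "vn_entropy (corner_gibbs p H) + hs_prod H (corner_gibbs p H) = ln (partition_fun p H)"
proof -
  obtain e k b where e: "orthonormal e" and k: "p ** H ** p = spec_mat e k" and b: "p = spec_mat e b"
    and b01: "\<And>j. b j = 0 \<or> b j = 1"
    using projection_corner_diagonalization[OF p(1) H] by metis
  define Z where "Z = partition_fun p H"
  have Z: "Z > 0" unfolding Z_def by (rule partition_fun_pos[OF p H])
  define t where "t = (\<lambda>j. b j * exp (k j) / Z)"
  have G: "corner_gibbs p H = spec_mat e t"
    unfolding t_def Z_def by (rule corner_gibbs_diagonal[OF e k b])
  have sum_t: "(\<Sum>j\<in>UNIV. t j) = 1"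
    using Z corner_gibbs_diagonal(1)[OF e k b]
    by (simp add: t_def sum_divide_distrib[symmetric] Z_def)
  have "0 \<le> t j" for j
    using Z b01[of j] by (auto simp: t_def)
  then have st: "corner_gibbs p H \<in> states"
    unfolding G by (intro spec_mat_in_states e sum_t)
  have btb: "b j * t j * b j = t j" for j
    using b01[of j] by (auto simp: t_def)
  have "spec_mat e b ** spec_mat e t ** spec_mat e b = spec_mat e t"
    by (simp only: spec_mat_mult[OF e] btb)
  then have pGp: "p ** corner_gibbs p H ** p = corner_gibbs p H"
    by (simp only: G b[symmetric])
  show "corner_gibbs p H \<in> corner_states p"
    using st pGp by (simp add: corner_states_iff[OF p(1)])
  have "hs_prod H (corner_gibbs p H) = hs_prod (spec_mat e k) (spec_mat e t)"
    using hs_prod_corner[OF pGp, of H] by (simp only: k G)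
  also have "\<dots> = (\<Sum>j\<in>UNIV. k j * t j)"
    by (simp add: hs_prod_def spec_mat_mult[OF e] trace_spec_mat[OF e])
  finally have "vn_entropy (corner_gibbs p H) + hs_prod H (corner_gibbs p H)
      = (\<Sum>j\<in>UNIV. k j * t j - t j * ln (t j))"
    by (simp add: G vn_entropy_spec_mat[OF e] sum_subtractf)
  \<comment> \<open>Inside the corner \<open>ln (t j) = k j - ln Z\<close>; outside it both summands
    are 0.\<close>
  also have "\<dots> = (\<Sum>j\<in>UNIV. ln Z * t j)"
  proof (intro sum.cong refl)
    fix j
    show "k j * t j - t j * ln (t j) = ln Z * t j"
      using b01[of j] Z by (auto simp: t_def ln_div field_simps)
  qed
  also have "\<dots> = ln Z"
    by (simp add: sum_distrib_left[symmetric] sum_t)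
  finally show "vn_entropy (corner_gibbs p H) + hs_prod H (corner_gibbs p H) = ln (partition_fun p H)"
    by (simp add: Z_def)
qed

text \<open>\<sigma> and the Gibbs state are diagonal in different bases. The squared overlaps
  \<open>P i j\<close> form a doubly stochastic matrix, which turns the gap between the two sides
  into a weighted sum of the nonnegative terms of \<open>relative_entropy_term\<close>. In the
  equality case every term of positive weight vanishes, which fixes the action of \<sigma> on the
  eigenbasis of the Gibbs state.\<close>

lemma gibbs_variational_principle:
  assumes p: "mat_projection p" "p \<noteq> 0" and H: "hermitian H" and \<sigma>: "\<sigma> \<in> corner_states p"
  shows "vn_entropy \<sigma> + hs_prod H \<sigma> \<le> ln (partition_fun p H)"
    and "vn_entropy \<sigma> + hs_prod H \<sigma> = ln (partition_fun p H) \<Longrightarrow> \<sigma> = corner_gibbs p H"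
proof -
  obtain e k b where e: "orthonormal e" and k: "p ** H ** p = spec_mat e k" and b: "p = spec_mat e b"
    and b01: "\<And>j. b j = 0 \<or> b j = 1" and b0: "\<And>j. b j = 0 \<Longrightarrow> k j = 0"
    using projection_corner_diagonalization[OF p(1) H] by metis
  define Z where "Z = partition_fun p H"
  have Z: "Z > 0" unfolding Z_def by (rule partition_fun_pos[OF p H])
  have Zs: "Z = (\<Sum>j\<in>UNIV. b j * exp (k j))"
    unfolding Z_def by (rule corner_gibbs_diagonal[OF e k b])
  have st: "\<sigma> \<in> states" and p\<sigma>: "p ** \<sigma> ** p = \<sigma>"
    using \<sigma> corner_states_iff[OF p(1)] by auto
  obtain f s where f: "orthonormal f" and s: "\<sigma> = spec_mat f s"
    and s0: "\<And>i. 0 \<le> s i" and s1: "(\<Sum>i\<in>UNIV. s i) = 1"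
    using states_spectral[OF st] by blast
  define P where "P = (\<lambda>i j. (cmod (cip (e j) (f i)))\<^sup>2)"
  have P0: "0 \<le> P i j" for i j by (simp add: P_def)
  have P1: "(\<Sum>j\<in>UNIV. P i j) = 1" for i
    using orthonormal_parseval[OF e, of "f i"] by (simp add: P_def orthonormal_norm[OF f])
  have P2: "(\<Sum>i\<in>UNIV. P i j) = 1" for j
  proof -
    have "P i j = (cmod (cip (f i) (e j)))\<^sup>2" for i
      unfolding P_def by (subst cnj_cip[symmetric]) simp
    then show ?thesis
      using orthonormal_parseval[OF f, of "e j"] by (simp add: orthonormal_norm[OF e])
  qed
  \<comment> \<open>\<sigma> lives in the corner, so its eigenvectors of nonzero eigenvalue have no
    component along an \<open>e j\<close> outside the corner.\<close>
  have supp: "s i * cip (e j) (f i) = 0" if "b j = 0" for i j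
  proof -
    have "of_real (s i) * cip (e j) (f i) = cip (e j) (p ** \<sigma> ** p *v f i)"
      by (simp only: p\<sigma>) (simp add: s spec_mat_eigen[OF f] cip_smult_right)
    also have "\<dots> = cip (p *v e j) (\<sigma> ** p *v f i)"
      using hermitian_cip[of p "e j"] p(1)
      by (simp add: mat_projection_def matrix_vector_mul_assoc[symmetric] matrix_mul_assoc[symmetric])
    also have "\<dots> = 0"
      using that by (simp add: b spec_mat_eigen[OF e])
    finally show ?thesis .
  qed
  have sP: "s i * P i j * b j = s i * P i j" for i j
    using b01[of j] supp[of j i] by (auto simp: P_def)
  \<comment> \<open>The factor \<open>b j\<close> removes the directions outside the corner, where
    the Gibbs state has eigenvalue 0 and thus no genuine logarithm.\<close>
  let ?g = "\<lambda>i j. P i j * b j * (s i * ln (s i) - s i * ln (exp (k j) / Z) - s i + exp (k j) / Z)"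
  have g_nonneg: "?g i j \<ge> 0" for i j
    using P0[of i j] b01[of j] relative_entropy_term(1)[OF s0[of i], of "exp (k j) / Z"] Z by auto
  have "hs_prod H \<sigma> = Re (trace (\<sigma> ** spec_mat e k))"
    using hs_prod_corner[OF p\<sigma>, of H] by (simp add: k hs_prod_def trace_mult_commute)
  also have "\<dots> = (\<Sum>i\<in>UNIV. s i * (\<Sum>j\<in>UNIV. k j * P i j))"
    by (simp add: s trace_spec_mat_mult cip_spec_mat P_def)
  finally have hs: "hs_prod H \<sigma> = (\<Sum>i\<in>UNIV. \<Sum>j\<in>UNIV. s i * P i j * k j)"
    by (simp add: sum_distrib_left mult_ac)
  \<comment> \<open>Since the rows and columns of \<open>P\<close> sum to 1, the linear terms
    \<open>- s i\<close> and \<open>exp (k j) / Z\<close> contribute -1 and +1 and cancel.\<close>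
  have gap: "(\<Sum>i\<in>UNIV. \<Sum>j\<in>UNIV. ?g i j) = ln Z - (vn_entropy \<sigma> + hs_prod H \<sigma>)"
  proof -
    have split: "?g i j = s i * P i j * b j * ln (s i) - s i * P i j * b j * k j
        + s i * P i j * b j * (ln Z - 1) + P i j * (b j * exp (k j) / Z)" for i j
      using Z by (simp add: ln_div algebra_simps)
    have c1: "(\<Sum>i\<in>UNIV. \<Sum>j\<in>UNIV. s i * P i j * ln (s i)) = - vn_entropy \<sigma>"
    proof -
      have "(\<Sum>j\<in>UNIV. s i * P i j * ln (s i)) = s i * ln (s i)" for i
        using P1[of i] by (simp add: sum_distrib_left[symmetric] sum_distrib_right[symmetric])
      then show ?thesis by (simp add: s vn_entropy_spec_mat[OF f])
    qed
    have c2: "(\<Sum>i\<in>UNIV. \<Sum>j\<in>UNIV. s i * P i j * (ln Z - 1)) = ln Z - 1"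
    proof -
      have "(\<Sum>j\<in>UNIV. s i * P i j * (ln Z - 1)) = s i * (ln Z - 1)" for i
        using P1[of i] by (simp add: sum_distrib_left[symmetric] sum_distrib_right[symmetric])
      then show ?thesis using s1 by (simp only:) (simp add: sum_distrib_right[symmetric])
    qed
    have c3: "(\<Sum>i\<in>UNIV. \<Sum>j\<in>UNIV. P i j * (b j * exp (k j) / Z)) = 1"
    proof -
      have "(\<Sum>i\<in>UNIV. \<Sum>j\<in>UNIV. P i j * (b j * exp (k j) / Z))
          = (\<Sum>j\<in>UNIV. (\<Sum>i\<in>UNIV. P i j) * (b j * exp (k j) / Z))"
        unfolding sum_distrib_right by (rule sum.swap)
      also have "\<dots> = (\<Sum>j\<in>UNIV. b j * exp (k j)) / Z"
        by (simp add: P2 sum_divide_distrib)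
      finally show ?thesis using Z Zs by simp
    qed
    show ?thesis
      unfolding split sP by (simp only: sum.distrib sum_subtractf c1 c2 c3 hs)
  qed
  have "0 \<le> (\<Sum>i\<in>UNIV. \<Sum>j\<in>UNIV. ?g i j)"
    using g_nonneg by (intro sum_nonneg)
  then show "vn_entropy \<sigma> + hs_prod H \<sigma> \<le> ln (partition_fun p H)"
    using gap by (simp add: Z_def)
  assume "vn_entropy \<sigma> + hs_prod H \<sigma> = ln (partition_fun p H)"
  then have "(\<Sum>i\<in>UNIV. \<Sum>j\<in>UNIV. ?g i j) = 0"
    using gap by (simp add: Z_def)
  then have "(\<Sum>j\<in>UNIV. ?g i j) = 0" for i
    using g_nonneg sum_nonneg_eq_0_iff[of UNIV "\<lambda>i. \<Sum>j\<in>UNIV. ?g i j"] by (simp add: sum_nonneg)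
  then have g0: "?g i j = 0" for i j
    using g_nonneg sum_nonneg_eq_0_iff[of UNIV "?g i"] by simp
  have "\<sigma> *v e j = of_real (b j * exp (k j) / Z) *s e j" for j
  proof -
    \<comment> \<open>Either the overlap vanishes and both sides are 0, or the equality case
      identifies the two eigenvalues.\<close>
    have *: "of_real (s i) * cip (f i) (e j) = of_real (b j * exp (k j) / Z) * cip (f i) (e j)" for i
    proof (cases "cip (e j) (f i) = 0")
      case True
      then show ?thesis using cnj_cip[of "e j" "f i"] by simp
    next
      case False
      then have P: "P i j \<noteq> 0" by (simp add: P_def)
      have "s i = b j * exp (k j) / Z"
      proof (cases "b j = 0")
        case True
        then show ?thesis using supp[of j i] False by simp
      next
        case False
        then have "b j = 1" using b01[of j] by simp
        then show ?thesis
          using g0[of i j] P relative_entropy_term(2)[OF s0[of i], of "exp (k j) / Z"] Z by simp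
      qed
      then show ?thesis by simp
    qed
    have "\<sigma> *v e j = (\<Sum>i\<in>UNIV. (of_real (b j * exp (k j) / Z) * cip (f i) (e j)) *s f i)"
      by (simp only: s spec_mat_vec *)
    also have "\<dots> = of_real (b j * exp (k j) / Z) *s (\<Sum>i\<in>UNIV. cip (f i) (e j) *s f i)"
      by (simp add: vec_eq_iff sum_distrib_left mult.assoc)
    finally show ?thesis by (simp only: orthonormal_expansion[OF f])
  qed
  then show "\<sigma> = corner_gibbs p H"
    unfolding corner_gibbs_diagonal(2)[OF e k b] Z_def by (rule spec_mat_eqI[OF e])
qed

section \<open>The hypograph of the entropy\<close>

lemma mat_projection_mat_1: "mat_projection (mat 1 :: complex^'n^'n)"
  by (simp add: mat_projection_def hermitian_mat_1)

lemma mat_1_neq_0: "(mat 1 :: complex^'n^'n) \<noteq> 0"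
  by (auto simp: vec_eq_iff mat_def)

lemma corner_states_mat_1: "corner_states (mat 1) = states"
  by (auto simp: corner_states_iff[OF mat_projection_mat_1])

lemma vn_entropy_le_log_partition:
  assumes "\<sigma> \<in> states" "hermitian H"
  shows "vn_entropy \<sigma> + hs_prod H \<sigma> \<le> ln (partition_fun (mat 1) H)"
  using gibbs_variational_principle(1)[OF mat_projection_mat_1 mat_1_neq_0] assms
  by (simp add: corner_states_mat_1)

text \<open>The logarithm of \<sigma> would be an optimal \<open>H\<close>, but it does not exist if
  \<sigma> has a kernel. Shifting all eigenvalues by \<open>h > 0\<close> costs at most
  \<open>ln (1 + n * h)\<close>.\<close>

lemma vn_entropy_approx:
  fixes \<sigma> :: "complex^'n^'n"
  assumes \<sigma>: "\<sigma> \<in> states" and d: "d > 0"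
  shows "\<exists>H. hermitian H \<and> ln (partition_fun (mat 1) H) < vn_entropy \<sigma> + hs_prod H \<sigma> + d"
proof -
  obtain f s where f: "orthonormal f" and s: "\<sigma> = spec_mat f s"
    and s0: "\<And>i. 0 \<le> s i" and s1: "(\<Sum>i\<in>UNIV. s i) = 1"
    using states_spectral[OF \<sigma>] by blast
  define n where "n = real CARD('n)"
  have n: "n > 0" by (simp add: n_def)
  \<comment> \<open>With \<open>n * h = d / 2\<close> the final bound is strict.\<close>
  define h where "h = d / (2 * n)"
  have h: "h > 0" using d n by (simp add: h_def)
  have pos: "s i + h > 0" for i using s0[of i] h by simp
  define H where "H = spec_mat f (\<lambda>i. ln (s i + h))"
  have H: "hermitian H" by (simp add: H_def hermitian_spec_mat)
  have "partition_fun (mat 1) H = (\<Sum>i\<in>UNIV. s i + h)"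
    using pos by (simp add: partition_fun_def H_def mat_exp_spec_mat[OF f] trace_spec_mat[OF f] less_imp_neq)
  also have "\<dots> = 1 + n * h"
    by (simp add: sum.distrib s1 n_def)
  finally have "ln (partition_fun (mat 1) H) \<le> n * h"
    using n h by (simp add: ln_add_one_self_le_self)
  also have "\<dots> < d" using n d by (simp add: h_def)
  also have "\<dots> \<le> vn_entropy \<sigma> + hs_prod H \<sigma> + d"
  proof -
    have "hs_prod H \<sigma> = (\<Sum>i\<in>UNIV. ln (s i + h) * s i)"
      by (simp add: hs_prod_def H_def s spec_mat_mult[OF f] trace_spec_mat[OF f])
    moreover have "(\<Sum>i\<in>UNIV. s i * ln (s i)) \<le> (\<Sum>i\<in>UNIV. ln (s i + h) * s i)"
    proof (rule sum_mono)
      fix i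
      show "s i * ln (s i) \<le> ln (s i + h) * s i"
        using s0[of i] h by (cases "s i = 0") (simp_all add: mult.commute mult_left_mono)
    qed
    ultimately show ?thesis by (simp add: s vn_entropy_spec_mat[OF f])
  qed
  finally show ?thesis using H by blast
qed

text \<open>The logarithm of the partition function is the Legendre transform of the entropy; this
  is the inverse transform. Quantifying over all \<open>H\<close> avoids an optimal one, which need
  not exist.\<close>

lemma le_vn_entropy_iff:
  assumes "\<sigma> \<in> states"
  shows "s \<le> vn_entropy \<sigma> \<longleftrightarrow> (\<forall>H. hermitian H \<longrightarrow> s + hs_prod H \<sigma> \<le> ln (partition_fun (mat 1) H))"
proof
  assume "s \<le> vn_entropy \<sigma>"
  then show "\<forall>H. hermitian H \<longrightarrow> s + hs_prod H \<sigma> \<le> ln (partition_fun (mat 1) H)"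
    using vn_entropy_le_log_partition[OF assms] by (meson add_le_cancel_right order_trans)
next
  assume *: "\<forall>H. hermitian H \<longrightarrow> s + hs_prod H \<sigma> \<le> ln (partition_fun (mat 1) H)"
  show "s \<le> vn_entropy \<sigma>"
  proof (rule field_le_epsilon)
    fix d :: real
    assume "0 < d"
    from vn_entropy_approx[OF assms this] obtain H where
      H: "hermitian H" "ln (partition_fun (mat 1) H) < vn_entropy \<sigma> + hs_prod H \<sigma> + d" by blast
    then have "s + hs_prod H \<sigma> \<le> ln (partition_fun (mat 1) H)" using * by blast
    then show "s \<le> vn_entropy \<sigma> + d" using H(2) by linarith
  qed
qed

section \<open>Convexity and compactness of the state space\<close>

lemma trace_add: "trace (A + B) = trace A + trace (B :: complex^'n^'n)"
  by (simp add: trace_def sum.distrib)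

lemma trace_scaleR: "trace (r *\<^sub>R A) = r *\<^sub>R trace (A :: complex^'n^'n)"
  by (simp add: trace_def scaleR_right.sum)

lemma linear_trace: "linear (trace :: complex^'n^'n \<Rightarrow> complex)"
  by (intro linearI trace_add trace_scaleR)

lemma linear_hs_prod: "linear (hs_prod (H :: complex^'n^'n))"
proof (rule linearI)
  show "hs_prod H (A + B) = hs_prod H A + hs_prod H B" for A B
    by (simp add: hs_prod_def matrix_add_ldistrib trace_add)
  show "hs_prod H (r *\<^sub>R A) = r *\<^sub>R hs_prod H A" for r A
  proof -
    have "H ** (r *\<^sub>R A) = r *\<^sub>R (H ** A)"
      by (simp add: vec_eq_iff matrix_matrix_mult_def scaleR_right.sum)
    then show ?thesis by (simp add: hs_prod_def trace_scaleR)
  qed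
qed

lemma linear_quadratic_form: "linear (\<lambda>A :: complex^'n^'n. Re (cip v (A *v v)))"
proof (rule linearI)
  show "Re (cip v ((A + B) *v v)) = Re (cip v (A *v v)) + Re (cip v (B *v v))" for A B
    by (simp add: matrix_vector_mult_add_rdistrib cip_add_right)
  show "Re (cip v ((r *\<^sub>R A) *v v)) = r *\<^sub>R Re (cip v (A *v v))" for r A
  proof -
    have "(r *\<^sub>R A) *v v = complex_of_real r *s (A *v v)"
      by (simp add: vec_eq_iff matrix_vector_mult_def sum_distrib_left scaleR_conv_of_real[where 'a=complex] mult.assoc)
    then show ?thesis by (simp add: cip_smult_right)
  qed
qed

lemma closed_linear_vimage:
  fixes f :: "'a::euclidean_space \<Rightarrow> 'b::real_normed_vector"
  assumes "linear f" "closed S"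
  shows "closed (f -` S)"
  using assms by (intro continuous_closed_vimage linear_continuous_at linear_conv_bounded_linear[THEN iffD1])

lemma states_eq:
  "states = {A. hermitian A} \<inter> (\<Inter>v. (\<lambda>A. Re (cip v (A *v v))) -` {0..}) \<inter> trace -` {1}"
  by (auto simp: states_def psd_def cip_def)

lemma closed_states: "closed (states :: (complex^'n^'n) set)"
  unfolding states_eq
  by (intro closed_Int closed_INT ballI closed_linear_vimage linear_quadratic_form linear_trace
      closed_subspace[OF subspace_hermitian]) auto

lemma convex_states: "convex (states :: (complex^'n^'n) set)"
  unfolding states_eq
  by (intro convex_Int convex_INT convex_linear_vimage linear_quadratic_form linear_trace
      subspace_imp_convex[OF subspace_hermitian]) auto

text \<open>A state is a convex combination of projections onto unit vectors, so its entries have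
  modulus at most 1.\<close>

lemma bounded_states: "bounded (states :: (complex^'n^'n) set)"
proof -
  have "norm \<rho> \<le> (\<Sum>r\<in>(UNIV :: 'n set). \<Sum>c\<in>(UNIV :: 'n set). 1)" if \<rho>: "\<rho> \<in> states" for \<rho> :: "complex^'n^'n"
  proof -
    obtain f s where f: "orthonormal f" and s: "\<rho> = spec_mat f s"
      and s0: "\<And>i. 0 \<le> s i" and s1: "(\<Sum>i\<in>UNIV. s i) = 1"
      using states_spectral[OF \<rho>] by blast
    have entry_le: "norm (\<rho> $ r $ c) \<le> 1" for r c
    proof -
      have f1: "cmod (f j $ i) \<le> 1" for i j
        using Finite_Cartesian_Product.norm_nth_le[of "f j" i] by (simp add: orthonormal_norm[OF f])
      have "norm (\<rho> $ r $ c) \<le> (\<Sum>j\<in>UNIV. norm (of_real (s j) * (f j $ r * cnj (f j $ c))))"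
        unfolding s spec_mat_def vec_lambda_beta by (rule norm_sum)
      also have "\<dots> \<le> (\<Sum>j\<in>UNIV. s j)"
        using s0 f1 by (intro sum_mono) (simp add: norm_mult mult_left_le mult_le_one)
      finally show ?thesis using s1 by simp
    qed
    have "norm \<rho> \<le> (\<Sum>r\<in>UNIV. norm (\<rho> $ r))"
      unfolding norm_vec_def by (rule L2_set_le_sum) simp
    also have "\<dots> \<le> (\<Sum>r\<in>UNIV. \<Sum>c\<in>UNIV. norm (\<rho> $ r $ c))"
      by (intro sum_mono) (simp add: norm_vec_def[of "_ $ _"] L2_set_le_sum)
    also have "\<dots> \<le> (\<Sum>r\<in>(UNIV :: 'n set). \<Sum>c\<in>(UNIV :: 'n set). 1)"
      by (intro sum_mono entry_le)
    finally show ?thesis .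
  qed
  then show ?thesis unfolding bounded_iff by blast
qed

text \<open>The truncation at \<open>-1\<close> makes the hypograph compact and keeps it strictly below the
  (nonnegative) entropy.\<close>

definition entropy_hypograph :: "((complex^'n^'n) \<times> real) set" where
  "entropy_hypograph = {(\<sigma>, s). \<sigma> \<in> states \<and> -1 \<le> s \<and> s \<le> vn_entropy \<sigma>}"

text \<open>With one closed half-space for each Hermitian \<open>H\<close>, convexity and closedness
  are inherited from the half-spaces.\<close>

lemma entropy_hypograph_eq:
  "entropy_hypograph = (states \<times> {-1..}) \<inter>
     (\<Inter>H\<in>{H. hermitian H}. (\<lambda>x. snd x + hs_prod H (fst x)) -` {..ln (partition_fun (mat 1) H)})"
  by (auto simp: entropy_hypograph_def le_vn_entropy_iff)

lemma linear_entropy_functional: "linear (\<lambda>x. snd x + hs_prod H (fst x))"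
  using linear_compose_add[OF linear_snd linear_compose[OF linear_fst linear_hs_prod[of H]]]
  by (simp add: o_def)

lemma convex_entropy_hypograph: "convex (entropy_hypograph :: ((complex^'n^'n) \<times> real) set)"
  unfolding entropy_hypograph_eq
  by (intro convex_Int convex_INT convex_linear_vimage linear_entropy_functional convex_Times convex_states)
    auto

lemma compact_entropy_hypograph: "compact (entropy_hypograph :: ((complex^'n^'n) \<times> real) set)"
proof -
  have "closed (entropy_hypograph :: ((complex^'n^'n) \<times> real) set)"
    unfolding entropy_hypograph_eq
    by (intro closed_Int closed_INT ballI closed_linear_vimage linear_entropy_functional closed_Times closed_states)
      auto
  moreover have "(entropy_hypograph :: ((complex^'n^'n) \<times> real) set)
      \<subseteq> states \<times> {-1..ln (partition_fun (mat 1) (0 :: complex^'n^'n))}"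
  proof -
    have "vn_entropy \<sigma> \<le> ln (partition_fun (mat 1) (0 :: complex^'n^'n))" if "\<sigma> \<in> states" for \<sigma> :: "complex^'n^'n"
      using vn_entropy_le_log_partition[OF that hermitian_0]
      by (simp add: linear_0[OF linear_hs_prod] hs_prod_commute[of 0])
    then show ?thesis
      by (fastforce simp: entropy_hypograph_def)
  qed
  then have "bounded (entropy_hypograph :: ((complex^'n^'n) \<times> real) set)"
    by (rule bounded_subset[rotated]) (intro bounded_Times bounded_states bounded_closed_interval)
  ultimately show ?thesis by (simp add: compact_eq_bounded_closed)
qed


section \<open>Faces of the state space\<close>

text \<open>The form is a sum of nonnegative terms, so \<open>v\<close> has no component along an
  eigenvector of nonzero eigenvalue. This upgrades a vanishing expectation to membership in the
  kernel.\<close>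

lemma state_kernel:
  assumes "\<sigma> \<in> states" "Re (cip v (\<sigma> *v v)) = 0"
  shows "\<sigma> *v v = 0"
proof -
  obtain f s where f: "orthonormal f" and s: "\<sigma> = spec_mat f s"
    and s0: "\<And>i. 0 \<le> s i"
    using states_spectral[OF assms(1)] by blast
  have "(\<Sum>i\<in>UNIV. s i * (cmod (cip (f i) v))\<^sup>2) = 0"
    using assms(2) by (simp add: s cip_spec_mat)
  then have "s i * (cmod (cip (f i) v))\<^sup>2 = 0" for i
    using s0 by (subst (asm) sum_nonneg_eq_0_iff) auto
  then have "of_real (s i) * cip (f i) v = 0" for i
    by (metis mult_eq_0_iff norm_eq_zero of_real_0 power_eq_0_iff)
  then show ?thesis by (simp only: s spec_mat_vec) simp
qed

lemma state_quadratic_form_le: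
  assumes "\<sigma> \<in> states"
  shows "Re (cip v (\<sigma> *v v)) \<le> (norm v)\<^sup>2"
proof -
  obtain f s where f: "orthonormal f" and s: "\<sigma> = spec_mat f s"
    and s0: "\<And>i. 0 \<le> s i" and s1: "(\<Sum>i\<in>UNIV. s i) = 1"
    using states_spectral[OF assms] by blast
  have "s i \<le> 1" for i using member_le_sum[of i UNIV s] s0 s1 by simp
  then have "(\<Sum>i\<in>UNIV. s i * (cmod (cip (f i) v))\<^sup>2) \<le> (\<Sum>i\<in>UNIV. 1 * (cmod (cip (f i) v))\<^sup>2)"
    by (intro sum_mono mult_right_mono) auto
  then show ?thesis by (simp add: s cip_spec_mat orthonormal_parseval[OF f])
qed

lemma statesI:
  assumes "hermitian \<sigma>" "\<And>v. 0 \<le> Re (cip v (\<sigma> *v v))" "trace \<sigma> = 1"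
  shows "\<sigma> \<in> states"
  using assms by (simp add: states_def psd_def cip_def)

lemma state_hermitian: "\<sigma> \<in> states \<Longrightarrow> hermitian \<sigma>"
  by (simp add: states_def psd_def)

lemma state_quadratic_form_nonneg: "\<sigma> \<in> states \<Longrightarrow> 0 \<le> Re (cip v (\<sigma> *v v))"
  by (simp add: states_def psd_def cip_def)

text \<open>Domination leaves a positive semidefinite remainder, so \<sigma>0 is a proper convex
  combination of \<sigma> and the normalized remainder; a face that contains \<sigma>0 contains both
  ends.\<close>

lemma dominated_state_in_face:
  assumes face: "\<Phi> face_of states" and \<sigma>0: "\<sigma>0 \<in> \<Phi>" and \<sigma>: "\<sigma> \<in> states"
    and c: "c > 0" and dom: "\<And>v. c * Re (cip v (\<sigma> *v v)) \<le> Re (cip v (\<sigma>0 *v v))"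
  shows "\<sigma> \<in> \<Phi>"
proof -
  \<comment> \<open>The cap at 1/2 keeps the weight \<open>1 - \<epsilon>\<close> of the remainder
    positive.\<close>
  define \<epsilon> where "\<epsilon> = min c (1 / 2)"
  have \<epsilon>: "0 < \<epsilon>" "\<epsilon> < 1" "\<epsilon> \<le> c" using c by (auto simp: \<epsilon>_def)
  have \<sigma>0s: "\<sigma>0 \<in> states" using face \<sigma>0 face_of_imp_subset by blast
  define \<sigma>' where "\<sigma>' = (1 / (1 - \<epsilon>)) *\<^sub>R (\<sigma>0 - \<epsilon> *\<^sub>R \<sigma>)"
  have "\<sigma>' \<in> states"
  proof (rule statesI)
    show "hermitian \<sigma>'"
      unfolding \<sigma>'_def using \<sigma> \<sigma>0s by (intro hermitian_scaleR hermitian_diff state_hermitian)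
    show "0 \<le> Re (cip v (\<sigma>' *v v))" for v
    proof -
      have "\<epsilon> * Re (cip v (\<sigma> *v v)) \<le> c * Re (cip v (\<sigma> *v v))"
        using \<epsilon> state_quadratic_form_nonneg[OF \<sigma>] by (intro mult_right_mono)
      also note dom[of v]
      finally have "0 \<le> Re (cip v ((\<sigma>0 - \<epsilon> *\<^sub>R \<sigma>) *v v))"
        by (simp only: linear_diff[OF linear_quadratic_form] linear_scale[OF linear_quadratic_form]) simp
      then show ?thesis
        using \<epsilon> unfolding \<sigma>'_def linear_scale[OF linear_quadratic_form] by simp
    qed
    have "trace \<sigma> = 1" "trace \<sigma>0 = 1" using \<sigma> \<sigma>0s by (auto simp: states_def)
    then have "trace \<sigma>' = (1 / (1 - \<epsilon>)) *\<^sub>R ((1 - \<epsilon>) *\<^sub>R 1)"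
      unfolding \<sigma>'_def linear_scale[OF linear_trace] linear_diff[OF linear_trace]
      by (simp add: scaleR_diff_left)
    then show "trace \<sigma>' = 1" using \<epsilon> by simp
  qed
  moreover have eq: "\<sigma>0 = (1 - \<epsilon>) *\<^sub>R \<sigma>' + \<epsilon> *\<^sub>R \<sigma>"
    using \<epsilon> by (simp add: \<sigma>'_def)
  show ?thesis
  proof (cases "\<sigma>' = \<sigma>")
    case True
    then have "\<sigma>0 = \<sigma>" using eq by (simp add: scaleR_left_distrib[symmetric])
    then show ?thesis using \<sigma>0 by simp
  next
    case False
    then have "\<sigma>0 \<in> open_segment \<sigma>' \<sigma>"
      unfolding in_segment using eq \<epsilon> by blast
    then show ?thesis
      using face_ofD[OF face _ \<open>\<sigma>' \<in> states\<close> \<sigma> \<sigma>0] by blast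
  qed
qed

text \<open>\<open>p\<close> is the support projection of a relative interior point \<sigma>0. A
  state of the face is supported there because the segment from it can be prolonged beyond
  \<sigma>0; conversely \<sigma>0 dominates a multiple of every state of the corner.\<close>

lemma face_of_states_corner:
  fixes \<Phi> :: "(complex^'n^'n) set"
  assumes face: "\<Phi> face_of states" and ne: "\<Phi> \<noteq> {}"
  obtains p where "mat_projection p" "p \<noteq> 0" "corner_states p = \<Phi>"
proof -
  have cvx: "convex \<Phi>" using face by (rule face_of_imp_convex)
  then obtain \<sigma>0 where ri: "\<sigma>0 \<in> rel_interior \<Phi>"
    using rel_interior_eq_empty ne by blast
  then have \<sigma>0: "\<sigma>0 \<in> \<Phi>" using rel_interior_subset by blast
  have sub: "\<Phi> \<subseteq> states" using face by (rule face_of_imp_subset)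
  obtain e s where e: "orthonormal e" and s: "\<sigma>0 = spec_mat e s"
    and s0: "\<And>i. 0 \<le> s i" and s1: "(\<Sum>i\<in>UNIV. s i) = 1"
    using states_spectral[of \<sigma>0] \<sigma>0 sub by blast
  define b where "b = (\<lambda>j. if s j = 0 then 0 else 1 :: real)"
  define p where "p = spec_mat e b"
  have pp: "p ** p = p"
    unfolding p_def spec_mat_mult[OF e] by (rule arg_cong[of _ _ "spec_mat e"]) (auto simp: b_def)
  have hp: "hermitian p" by (simp add: p_def hermitian_spec_mat)
  have p: "mat_projection p" using pp hp by (simp add: mat_projection_def)
  have norm_p: "(norm (p *v v))\<^sup>2 = (\<Sum>j\<in>UNIV. b j * (cmod (cip (e j) v))\<^sup>2)" for v
  proof -
    have "complex_of_real ((norm (p *v v))\<^sup>2) = cip v (p *v (p *v v))"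
      by (simp only: cip_self[symmetric] hermitian_cip[OF hp])
    also have "\<dots> = cip v (p *v v)" by (simp add: matrix_vector_mul_assoc pp)
    also have "\<dots> = complex_of_real (\<Sum>j\<in>UNIV. b j * (cmod (cip (e j) v))\<^sup>2)"
      by (simp only: p_def cip_spec_mat)
    finally show ?thesis by (simp only: of_real_eq_iff)
  qed
  have p0: "p \<noteq> 0"
  proof
    assume "p = 0"
    then have "spec_mat e b = spec_mat e (\<lambda>_. 0)"
      by (simp add: p_def) (simp add: spec_mat_def vec_eq_iff)
    then have "s j = 0" for j
      using spec_mat_inject[OF e, of b "\<lambda>_. 0" j] by (auto simp: b_def split: if_splits)
    then show False using s1 by simp
  qed
  have "corner_states p = \<Phi>"
  proof (intro subset_antisym subsetI)
    fix \<sigma> assume \<sigma>\<Phi>: "\<sigma> \<in> \<Phi>"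
    then have \<sigma>: "\<sigma> \<in> states" using sub by blast
    obtain m where m: "m > 1" and "(1 - m) *\<^sub>R \<sigma> + m *\<^sub>R \<sigma>0 \<in> \<Phi>"
      using convex_rel_interior_iff[OF cvx ne] ri \<sigma>\<Phi> by blast
    then have ext: "(1 - m) *\<^sub>R \<sigma> + m *\<^sub>R \<sigma>0 \<in> states" using sub by blast
    \<comment> \<open>At a kernel vector of \<sigma>0 the prolonged state has the value
      \<open>(1 - m) * ?q \<sigma>\<close> with \<open>1 - m < 0\<close>, so positivity of both
      states leaves only 0.\<close>
    have ker: "\<sigma> *v e j = 0" if "s j = 0" for j
    proof -
      let ?q = "\<lambda>A. Re (cip (e j) (A *v e j))"
      have "?q \<sigma>0 = 0" using that by (simp add: s spec_mat_eigen[OF e])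
      then have "0 \<le> (1 - m) * ?q \<sigma>"
        using state_quadratic_form_nonneg[OF ext, of "e j"]
        by (simp add: linear_add[OF linear_quadratic_form] linear_scale[OF linear_quadratic_form])
      then have "?q \<sigma> \<le> 0" using m by (simp add: zero_le_mult_iff)
      then show ?thesis
        using state_quadratic_form_nonneg[OF \<sigma>, of "e j"] by (intro state_kernel[OF \<sigma>]) simp
    qed
    have "\<sigma> ** p = \<sigma>"
      by (rule orthonormal_ext[OF e])
        (auto simp: matrix_vector_mul_assoc[symmetric] p_def spec_mat_eigen[OF e] b_def ker)
    moreover have "p ** \<sigma> = \<sigma>"
    proof -
      have "mat_adjoint (\<sigma> ** p) = mat_adjoint \<sigma>" by (simp only: \<open>\<sigma> ** p = \<sigma>\<close>)
      then show ?thesis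
        using hp state_hermitian[OF \<sigma>] by (simp add: mat_adjoint_mult hermitian_def)
    qed
    ultimately have "p ** \<sigma> ** p = \<sigma>" by simp
    then show "\<sigma> \<in> corner_states p" using \<sigma> by (simp add: corner_states_iff[OF p])
  next
    fix \<sigma> assume "\<sigma> \<in> corner_states p"
    then have \<sigma>: "\<sigma> \<in> states" and p\<sigma>: "p ** \<sigma> ** p = \<sigma>"
      by (auto simp: corner_states_iff[OF p])
    \<comment> \<open>The least nonzero eigenvalue of \<sigma>0; the entry 1 in place of zero
      eigenvalues keeps the minimum positive.\<close>
    define c where "c = Min (range (\<lambda>j. if s j = 0 then 1 else s j))"
    have "\<forall>x\<in>range (\<lambda>j. if s j = 0 then 1 else s j). 0 < x"
      using s0 by (auto simp: less_le)
    then have c: "c > 0" unfolding c_def by (subst Min_gr_iff) auto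
    have cb: "c * b j \<le> s j" for j
      unfolding c_def b_def using Min_le[of "range (\<lambda>j. if s j = 0 then 1 else s j)" "if s j = 0 then 1 else s j"]
      by auto
    show "\<sigma> \<in> \<Phi>"
    proof (rule dominated_state_in_face[OF face \<sigma>0 \<sigma> c])
      fix v
      have "cip v (\<sigma> *v v) = cip v (p *v (\<sigma> *v (p *v v)))"
        by (subst p\<sigma>[symmetric]) (simp only: matrix_vector_mul_assoc matrix_mul_assoc)
      also have "\<dots> = cip (p *v v) (\<sigma> *v (p *v v))"
        by (rule hermitian_cip[OF hp])
      finally have "Re (cip v (\<sigma> *v v)) \<le> (norm (p *v v))\<^sup>2"
        using state_quadratic_form_le[OF \<sigma>] by simp
      then have "c * Re (cip v (\<sigma> *v v)) \<le> c * (\<Sum>j\<in>UNIV. b j * (cmod (cip (e j) v))\<^sup>2)"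
        using c unfolding norm_p by (intro mult_left_mono) auto
      also have "\<dots> = (\<Sum>j\<in>UNIV. c * b j * (cmod (cip (e j) v))\<^sup>2)"
        by (simp add: sum_distrib_left mult.assoc)
      also have "\<dots> \<le> (\<Sum>j\<in>UNIV. s j * (cmod (cip (e j) v))\<^sup>2)"
        using cb by (intro sum_mono mult_right_mono) auto
      also have "\<dots> = Re (cip v (\<sigma>0 *v v))" by (simp add: s cip_spec_mat)
      finally show "c * Re (cip v (\<sigma> *v v)) \<le> Re (cip v (\<sigma>0 *v v))" .
    qed
  qed
  with p p0 show ?thesis by (rule that)
qed

section \<open>The maximum-entropy projection\<close>

lemma linear_expect: "linear (expect (B :: 'r::finite \<Rightarrow> complex^'n^'n))"
  by (rule linearI)
    (simp_all add: expect_def vec_eq_iff linear_add[OF linear_hs_prod] linear_scale[OF linear_hs_prod])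

lemma linear_hs_prod_left: "linear (\<lambda>H. hs_prod H (A :: complex^'n^'n))"
  using linear_hs_prod[of A] by (simp add: hs_prod_commute[of _ A])

lemma hs_prod_span_cong:
  assumes "expect B \<sigma> = expect B \<tau>" "H \<in> span (range B)"
  shows "hs_prod H \<sigma> = hs_prod H \<tau>"
  using assms(2)
proof (induction rule: span_induct_alt)
  case base
  then show ?case by (simp add: linear_0[OF linear_hs_prod_left])
next
  case (step r X H)
  then obtain i where "X = B i" by blast
  then have "hs_prod X \<sigma> = hs_prod X \<tau>"
    using arg_cong[OF assms(1), of "\<lambda>z. z $ i"] by (simp add: expect_def)
  then show ?case
    using step by (simp add: linear_add[OF linear_hs_prod_left] linear_scale[OF linear_hs_prod_left])
qed

lemma hermitian_span:
  assumes "\<And>i. hermitian (B i)" "H \<in> span (range B)"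
  shows "hermitian H"
proof -
  have "span (range B) \<subseteq> {A. hermitian A}"
    using assms(1) by (intro span_minimal subspace_hermitian) auto
  then show ?thesis using assms(2) by blast
qed

lemma inner_expect: "h \<bullet> expect B \<sigma> = hs_prod (\<Sum>i\<in>UNIV. (h $ i) *\<^sub>R B i) \<sigma>"
  by (simp add: inner_vec_def expect_def linear_sum[OF linear_hs_prod_left] linear_scale[OF linear_hs_prod_left])

lemma sum_in_span_range: "(\<Sum>i\<in>UNIV. (h $ i) *\<^sub>R B i) \<in> span (range B)"
  by (intro span_sum span_scale span_base) auto

lemma convex_convex_support: "convex (convex_support B)"
  unfolding convex_support_def by (intro convex_linear_image linear_expect convex_states)

text \<open>With \<open>face_of_states_corner\<close> this attaches a member of
  \<open>face_projections\<close> to every non-empty face of the convex support. A segment that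
  \<open>expect\<close> collapses to a point has no open image segment and is treated
  separately.\<close>

lemma face_preimage:
  assumes F: "F face_of convex_support B"
  shows "{\<rho> \<in> states. expect B \<rho> \<in> F} face_of states"
  unfolding face_of_def
proof (intro conjI ballI impI)
  have eq: "{\<rho> \<in> states. expect B \<rho> \<in> F} = states \<inter> expect B -` F" by auto
  show "convex {\<rho> \<in> states. expect B \<rho> \<in> F}"
    unfolding eq by (intro convex_Int convex_states convex_linear_vimage linear_expect face_of_imp_convex[OF F])
  fix a b x
  assume a: "a \<in> states" and b: "b \<in> states" and x: "x \<in> {\<rho> \<in> states. expect B \<rho> \<in> F}"
    and seg: "x \<in> open_segment a b"
  then obtain u where u: "0 < u" "u < 1" and xu: "x = (1 - u) *\<^sub>R a + u *\<^sub>R b"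
    by (auto simp: in_segment)
  have Ex: "expect B x = (1 - u) *\<^sub>R expect B a + u *\<^sub>R expect B b"
    by (simp add: xu linear_add[OF linear_expect] linear_scale[OF linear_expect])
  have "expect B a \<in> F \<and> expect B b \<in> F"
  proof (cases "expect B a = expect B b")
    case True
    then have "expect B x = expect B a" using Ex by (simp add: scaleR_left_distrib[symmetric])
    then show ?thesis using x True by simp
  next
    case False
    then have "expect B x \<in> open_segment (expect B a) (expect B b)"
      unfolding in_segment using Ex u by blast
    then show ?thesis
      using x a b by (intro face_ofD[OF F]) (auto simp: convex_support_def)
  qed
  then show "a \<in> {\<rho> \<in> states. expect B \<rho> \<in> F}" "b \<in> {\<rho> \<in> states. expect B \<rho> \<in> F}"
    using a b by auto
qed auto

lemma linear_expect_entropy: "linear (\<lambda>x. (expect B (fst x), snd x))"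
  by (intro linearI) (simp_all add: linear_add[OF linear_expect] linear_scale[OF linear_expect])

text \<open>No continuity of the entropy is involved: the height coordinate is continuous and is
  maximized over the compact slice of the hypograph above the given expectations.\<close>

lemma entropy_maximizer_exists:
  assumes "\<rho> \<in> states"
  obtains \<tau> where "\<tau> \<in> states" "expect B \<tau> = expect B \<rho>"
    "\<And>\<sigma>. \<sigma> \<in> states \<Longrightarrow> expect B \<sigma> = expect B \<rho> \<Longrightarrow> vn_entropy \<sigma> \<le> vn_entropy \<tau>"
proof -
  let ?g = "\<lambda>x. expect B (fst x)"
  have "linear ?g"
    using linear_compose[OF linear_fst linear_expect[of B]] by (simp add: o_def)
  then have "compact (entropy_hypograph \<inter> ?g -` {expect B \<rho>})"
    by (intro compact_Int_closed compact_entropy_hypograph closed_linear_vimage) auto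
  moreover have "(\<rho>, vn_entropy \<rho>) \<in> entropy_hypograph \<inter> ?g -` {expect B \<rho>}"
    using assms vn_entropy_nonneg[OF assms] by (simp add: entropy_hypograph_def)
  moreover have "continuous_on (entropy_hypograph \<inter> ?g -` {expect B \<rho>}) snd"
    by (intro continuous_intros)
  ultimately obtain x where x: "x \<in> entropy_hypograph \<inter> ?g -` {expect B \<rho>}"
    and max: "\<And>y. y \<in> entropy_hypograph \<inter> ?g -` {expect B \<rho>} \<Longrightarrow> snd y \<le> snd x"
    using continuous_attains_sup[of "entropy_hypograph \<inter> ?g -` {expect B \<rho>}" snd] by blast
  show ?thesis
  proof (rule that[of "fst x"])
    show "fst x \<in> states" "expect B (fst x) = expect B \<rho>"
      using x by (auto simp: entropy_hypograph_def)
    fix \<sigma> assume \<sigma>: "\<sigma> \<in> states" "expect B \<sigma> = expect B \<rho>"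
    then have "vn_entropy \<sigma> \<le> snd x"
      using max[of "(\<sigma>, vn_entropy \<sigma>)"] vn_entropy_nonneg[OF \<sigma>(1)] by (simp add: entropy_hypograph_def)
    also have "\<dots> \<le> vn_entropy (fst x)"
      using x by (auto simp: entropy_hypograph_def)
    finally show "vn_entropy \<sigma> \<le> vn_entropy (fst x)" .
  qed
qed

lemma corner_gibbs_family_eq: "corner_gibbs_family \<H> p = corner_gibbs p ` \<H>"
  by (auto simp: corner_gibbs_family_def corner_gibbs_def partition_fun_def)

text \<open>In the smallest face \<open>F\<close> containing the expectation of \<open>\<rho>\<close> a hyperplane supporting the
  entropy hypograph over \<open>F\<close> at its top cannot be vertical, for otherwise it would cut out a
  smaller face. Its slope is the Hamiltonian of the Gibbs state.\<close>

lemma entropy_maximizer_in_ext_gibbs_family: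
  fixes B :: "'r::finite \<Rightarrow> complex^'n^'n"
  assumes B: "\<And>i. hermitian (B i)" and \<tau>: "\<tau> \<in> states"
    and max: "\<And>\<sigma>. \<sigma> \<in> states \<Longrightarrow> expect B \<sigma> = expect B \<tau> \<Longrightarrow> vn_entropy \<sigma> \<le> vn_entropy \<tau>"
  shows "\<tau> \<in> ext_gibbs_family B"
proof -
  define x where "x = expect B \<tau>"
  define F where "F = \<Inter>{F. F face_of convex_support B \<and> x \<in> F}"
  have "convex_support B face_of convex_support B" "x \<in> convex_support B"
    using \<tau> face_of_refl[OF convex_convex_support[of B]] by (auto simp: convex_support_def x_def)
  then have F: "F face_of convex_support B" and xF: "x \<in> F"
    unfolding F_def by (auto intro!: face_of_Inter)
  have Fmin: "F \<subseteq> F'" if "F' face_of convex_support B" "x \<in> F'" for F'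
    using that by (auto simp: F_def)
  obtain p where p: "mat_projection p" "p \<noteq> 0" and corner: "corner_states p = {\<rho> \<in> states. expect B \<rho> \<in> F}"
    using face_of_states_corner[OF face_preimage[OF F]] \<tau> xF x_def by blast
  have pF: "p \<in> face_projections B"
    unfolding face_projections_def using p F xF corner by blast
  define C where "C = (\<lambda>x. (expect B (fst x), snd x)) ` entropy_hypograph \<inter> (F \<times> UNIV)"
  have CI: "(expect B \<sigma>, s) \<in> C" if "\<sigma> \<in> states" "expect B \<sigma> \<in> F" "-1 \<le> s" "s \<le> vn_entropy \<sigma>" for \<sigma> s
    using imageI[of "(\<sigma>, s)" entropy_hypograph "\<lambda>x. (expect B (fst x), snd x)"] that
    by (simp add: C_def entropy_hypograph_def)
  have cvx: "convex C"
    unfolding C_def by (intro convex_Int convex_linear_image linear_expect_entropy convex_entropy_hypograph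
        convex_Times face_of_imp_convex[OF F] convex_UNIV)
  have top: "(x, vn_entropy \<tau>) \<in> C" and bottom: "(x, -1) \<in> C"
    using CI[OF \<tau>] xF vn_entropy_nonneg[OF \<tau>] by (auto simp: x_def)
  \<comment> \<open>Otherwise the segment from \<open>(x, -1)\<close> could be prolonged past the
    top, giving a state with the same expectations and larger entropy. Starting at -1 keeps the two
    ends apart even if \<tau> has entropy 0.\<close>
  have not_interior: "(x, vn_entropy \<tau>) \<notin> rel_interior C"
  proof
    assume "(x, vn_entropy \<tau>) \<in> rel_interior C"
    then obtain m where m: "m > 1" and "(1 - m) *\<^sub>R (x, -1) + m *\<^sub>R (x, vn_entropy \<tau>) \<in> C"
      using convex_rel_interior_iff[OF cvx] bottom by blast
    then have "(x, m - 1 + m * vn_entropy \<tau>) \<in> C"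
      by (simp add: scaleR_left_distrib[symmetric])
    then obtain \<sigma> where \<sigma>: "\<sigma> \<in> states" "expect B \<sigma> = x" "m - 1 + m * vn_entropy \<tau> \<le> vn_entropy \<sigma>"
      by (auto simp: C_def entropy_hypograph_def)
    then have "m - 1 + m * vn_entropy \<tau> \<le> vn_entropy \<tau>"
      using max[OF \<sigma>(1)] by (simp add: x_def)
    moreover have "vn_entropy \<tau> \<le> m * vn_entropy \<tau>"
      using m vn_entropy_nonneg[OF \<tau>] by (simp add: mult_le_cancel_right1)
    ultimately show False using m by simp
  qed
  obtain a where "a \<noteq> 0" and a: "\<And>y. y \<in> C \<Longrightarrow> a \<bullet> (x, vn_entropy \<tau>) \<le> a \<bullet> y"
    and strict: "\<And>y. y \<in> rel_interior C \<Longrightarrow> a \<bullet> (x, vn_entropy \<tau>) < a \<bullet> y"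
    by (rule supporting_hyperplane_rel_boundary[OF cvx top not_interior], rule that)
  obtain h c where hc: "a = (h, c)" by (cases a)
  have sup: "h \<bullet> x + c * vn_entropy \<tau> \<le> h \<bullet> expect B \<sigma> + c * s"
    if "\<sigma> \<in> states" "expect B \<sigma> \<in> F" "-1 \<le> s" "s \<le> vn_entropy \<sigma>" for \<sigma> s
    using a[OF CI[OF that]] by (simp add: hc)
  have "c \<noteq> 0"
  proof
    assume c0: "c = 0"
    have ge: "h \<bullet> y \<ge> h \<bullet> x" if y: "y \<in> F" for y
    proof -
      obtain \<sigma> where \<sigma>: "\<sigma> \<in> states" "y = expect B \<sigma>"
        using y face_of_imp_subset[OF F] by (auto simp: convex_support_def)
      then show ?thesis
        using sup[OF \<sigma>(1), of "-1"] y vn_entropy_nonneg[OF \<sigma>(1)] by (simp add: c0)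
    qed
    have "F \<inter> {y. h \<bullet> y = h \<bullet> x} face_of F"
      by (rule face_of_Int_supporting_hyperplane_ge[OF face_of_imp_convex[OF F] ge])
    then have "F \<inter> {y. h \<bullet> y = h \<bullet> x} face_of convex_support B"
      using F by (rule face_of_trans)
    then have "F \<subseteq> {y. h \<bullet> y = h \<bullet> x}"
      using Fmin[of "F \<inter> {y. h \<bullet> y = h \<bullet> x}"] xF by blast
    \<comment> \<open>Minimality puts all of \<open>F\<close> into the hyperplane, whereas the
      support is strict at relative interior points of \<open>C\<close>.\<close>
    moreover obtain z where z: "z \<in> rel_interior C"
      using rel_interior_eq_empty[OF cvx] top by blast
    moreover have "fst z \<in> F"
      using z rel_interior_subset[of C] by (auto simp: C_def)
    ultimately have "a \<bullet> z = a \<bullet> (x, vn_entropy \<tau>)"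
      by (cases z) (auto simp: hc c0)
    then show False using strict[OF z] by simp
  qed
  moreover have "c \<le> 0"
  proof -
    \<comment> \<open>Comparing the two ends of the vertical segment over \<open>x\<close> fixes the
      sign.\<close>
    have "c * (vn_entropy \<tau> + 1) \<le> 0"
      using sup[OF \<tau>, of "-1"] xF vn_entropy_nonneg[OF \<tau>] by (simp add: x_def algebra_simps)
    then show ?thesis
      using vn_entropy_nonneg[OF \<tau>] by (simp add: mult_le_0_iff)
  qed
  ultimately have c: "c < 0" by simp
  \<comment> \<open>Division by the negative \<open>c\<close> turns the support inequality into
    maximality of entropy plus \<open>hs_prod H\<close> at \<tau> within the corner.\<close>
  define H where "H = (\<Sum>i\<in>UNIV. ((h /\<^sub>R c) $ i) *\<^sub>R B i)"
  have H: "H \<in> span (range B)" unfolding H_def by (rule sum_in_span_range)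
  have herm: "hermitian H" by (rule hermitian_span[OF B H])
  have hsH: "hs_prod H \<sigma> = (h \<bullet> expect B \<sigma>) / c" for \<sigma>
    unfolding H_def inner_expect[symmetric] by (simp add: divide_inverse mult.commute)
  have \<tau>p: "\<tau> \<in> corner_states p" using corner \<tau> xF by (simp add: x_def)
  have "ln (partition_fun p H) \<le> vn_entropy \<tau> + hs_prod H \<tau>"
  proof -
    let ?G = "corner_gibbs p H"
    have "?G \<in> corner_states p" by (rule corner_gibbs_state[OF p herm])
    then have G: "?G \<in> states" "expect B ?G \<in> F" using corner by auto
    have "h \<bullet> x + c * vn_entropy \<tau> \<le> h \<bullet> expect B ?G + c * vn_entropy ?G"
      using sup[OF G] vn_entropy_nonneg[OF G(1)] by simp
    then have "(h \<bullet> expect B ?G + c * vn_entropy ?G) / c \<le> (h \<bullet> x + c * vn_entropy \<tau>) / c"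
      using c by (intro divide_right_mono_neg) auto
    then have "vn_entropy ?G + hs_prod H ?G \<le> vn_entropy \<tau> + hs_prod H \<tau>"
      unfolding hsH x_def[symmetric] using c by (simp add: add_divide_distrib)
    then show ?thesis by (simp only: corner_gibbs_state(2)[OF p herm])
  qed
  then have "\<tau> = corner_gibbs p H"
    using gibbs_variational_principle[OF p herm \<tau>p] by simp
  then show ?thesis
    unfolding ext_gibbs_family_def corner_gibbs_family_eq using pF H by blast
qed

text \<open>The corner is the preimage of a face, so the expectations decide membership in it. Hence
  \<sigma> competes with \<tau> in the same variational problem, and their energies agree because
  \<open>H\<close> lies in the span.\<close>

lemma ext_gibbs_family_entropy:
  assumes B: "\<And>i. hermitian (B i)" and \<tau>: "\<tau> \<in> ext_gibbs_family B"
    and \<sigma>: "\<sigma> \<in> states" "expect B \<sigma> = expect B \<tau>"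
  shows "vn_entropy \<sigma> \<le> vn_entropy \<tau>" and "vn_entropy \<sigma> = vn_entropy \<tau> \<Longrightarrow> \<sigma> = \<tau>"
proof -
  obtain p H where pF: "p \<in> face_projections B" and H: "H \<in> span (range B)" and G: "\<tau> = corner_gibbs p H"
    using \<tau> by (auto simp: ext_gibbs_family_def corner_gibbs_family_eq)
  have herm: "hermitian H" by (rule hermitian_span[OF B H])
  obtain F where p: "mat_projection p" "p \<noteq> 0" and corner: "corner_states p = {\<rho> \<in> states. expect B \<rho> \<in> F}"
    using pF by (auto simp: face_projections_def)
  have "\<tau> \<in> corner_states p" unfolding G by (rule corner_gibbs_state[OF p herm])
  then have \<sigma>p: "\<sigma> \<in> corner_states p" using \<sigma> corner by simp
  have eq: "hs_prod H \<sigma> = hs_prod H \<tau>" by (rule hs_prod_span_cong[OF \<sigma>(2) H])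
  have Z: "vn_entropy \<tau> + hs_prod H \<tau> = ln (partition_fun p H)"
    unfolding G by (rule corner_gibbs_state[OF p herm])
  show "vn_entropy \<sigma> \<le> vn_entropy \<tau>"
    using gibbs_variational_principle(1)[OF p herm \<sigma>p] eq Z by simp
  show "vn_entropy \<sigma> = vn_entropy \<tau> \<Longrightarrow> \<sigma> = \<tau>"
    using gibbs_variational_principle(2)[OF p herm \<sigma>p] eq Z G by simp
qed

lemma ext_gibbs_family_states:
  assumes B: "\<And>i. hermitian (B i)" and \<tau>: "\<tau> \<in> ext_gibbs_family B"
  shows "\<tau> \<in> states"
proof -
  obtain p H where pF: "p \<in> face_projections B" and H: "H \<in> span (range B)" and G: "\<tau> = corner_gibbs p H"
    using \<tau> by (auto simp: ext_gibbs_family_def corner_gibbs_family_eq)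
  have "mat_projection p" "p \<noteq> 0" using pF by (auto simp: face_projections_def)
  then have "\<tau> \<in> corner_states p"
    unfolding G by (intro corner_gibbs_state hermitian_span[OF B H])
  then show ?thesis by (simp add: corner_states_def)
qed

text \<open>Two members of the extended family in one fibre bound each other's entropy, and the
  equality case identifies them.\<close>

lemma gibbs_projection_unique:
  assumes B: "\<And>i. hermitian (B i)" and \<tau>: "\<tau> \<in> ext_gibbs_family B" "expect B \<tau> = expect B \<rho>"
  shows "gibbs_projection B \<rho> = \<tau>"
  unfolding gibbs_projection_def
proof (rule the_equality)
  fix \<tau>' assume \<tau>': "\<tau>' \<in> ext_gibbs_family B \<and> expect B \<tau>' = expect B \<rho>"
  have s: "\<tau> \<in> states" "\<tau>' \<in> states"
    using ext_gibbs_family_states[where B = B, OF B] \<tau>(1) \<tau>' by blast+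
  have eq: "expect B \<tau>' = expect B \<tau>" using \<tau>(2) \<tau>' by simp
  have "vn_entropy \<tau>' = vn_entropy \<tau>"
    using ext_gibbs_family_entropy(1)[OF B \<tau>(1) s(2) eq]
      ext_gibbs_family_entropy(1)[OF B _ s(1) eq[symmetric]] \<tau>' by simp
  then show "\<tau>' = \<tau>"
    by (rule ext_gibbs_family_entropy(2)[OF B \<tau>(1) s(2) eq])
qed (use \<tau> in auto)

lemma gibbs_projection:
  assumes B: "\<And>i. hermitian (B i)" and \<rho>: "\<rho> \<in> states"
  shows "gibbs_projection B \<rho> \<in> ext_gibbs_family B"
    and "expect B (gibbs_projection B \<rho>) = expect B \<rho>"
    and "gibbs_projection B \<rho> \<in> states"
proof -
  obtain \<tau> where \<tau>: "\<tau> \<in> states" "expect B \<tau> = expect B \<rho>"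
    "\<And>\<sigma>. \<sigma> \<in> states \<Longrightarrow> expect B \<sigma> = expect B \<rho> \<Longrightarrow> vn_entropy \<sigma> \<le> vn_entropy \<tau>"
    using entropy_maximizer_exists[OF \<rho>, of B] by blast
  then have ext: "\<tau> \<in> ext_gibbs_family B"
    by (intro entropy_maximizer_in_ext_gibbs_family B) auto
  have eq: "gibbs_projection B \<rho> = \<tau>"
    by (rule gibbs_projection_unique[OF B ext \<tau>(2)])
  show "gibbs_projection B \<rho> \<in> ext_gibbs_family B"
    and "expect B (gibbs_projection B \<rho>) = expect B \<rho>"
    and "gibbs_projection B \<rho> \<in> states"
    unfolding eq by (fact ext \<tau>(1,2))+
qed

lemma gibbs_projection_max_entropy:
  assumes B: "\<And>i. hermitian (B i)" and \<rho>: "\<rho> \<in> states"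
    and \<sigma>: "\<sigma> \<in> states" "expect B \<sigma> = expect B \<rho>"
  shows "vn_entropy \<sigma> \<le> vn_entropy (gibbs_projection B \<rho>)"
    and "vn_entropy \<sigma> = vn_entropy (gibbs_projection B \<rho>) \<Longrightarrow> \<sigma> = gibbs_projection B \<rho>"
proof -
  have eq: "expect B \<sigma> = expect B (gibbs_projection B \<rho>)"
    using gibbs_projection(2)[where B = B, OF B \<rho>] \<sigma>(2) by simp
  show "vn_entropy \<sigma> \<le> vn_entropy (gibbs_projection B \<rho>)"
    by (rule ext_gibbs_family_entropy(1)[OF B gibbs_projection(1)[OF B \<rho>] \<sigma>(1) eq])
  show "vn_entropy \<sigma> = vn_entropy (gibbs_projection B \<rho>) \<Longrightarrow> \<sigma> = gibbs_projection B \<rho>"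
    by (rule ext_gibbs_family_entropy(2)[OF B gibbs_projection(1)[OF B \<rho>] \<sigma>(1) eq])
qed

section \<open>The divergence from a Gibbs family\<close>

lemma gibbs_family_eq: "gibbs_family \<H> = corner_gibbs (mat 1) ` \<H>"
  by (auto simp: gibbs_family_def corner_gibbs_def partition_fun_def)

text \<open>A Gibbs state of the full algebra is invertible, so the kernel condition holds, and its
  logarithm is \<open>H\<close> minus the scalar \<open>ln Z\<close>.\<close>

lemma rel_entropy_gibbs:
  fixes \<rho> :: "complex^'n^'n"
  assumes \<rho>: "\<rho> \<in> states" and H: "hermitian H"
  shows "rel_entropy \<rho> (corner_gibbs (mat 1) H)
    = ereal (ln (partition_fun (mat 1) H) - hs_prod H \<rho> - vn_entropy \<rho>)"
proof -
  obtain e h where e: "orthonormal e" and h: "H = spec_mat e h"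
    using hermitian_spectral[OF H] by blast
  define Z where "Z = partition_fun (mat 1) H"
  have Z: "Z > 0"
    unfolding Z_def by (rule partition_fun_pos[OF mat_projection_mat_1 mat_1_neq_0 H])
  have G: "corner_gibbs (mat 1) H = spec_mat e (\<lambda>j. exp (h j) / Z)"
    unfolding Z_def
    using corner_gibbs_diagonal(2)[OF e _ spec_mat_one[OF e, symmetric], of H h] by (simp add: h)
  have "spec_mat e (\<lambda>j. Z / exp (h j)) ** spec_mat e (\<lambda>j. exp (h j) / Z) = mat 1"
    using Z by (simp add: spec_mat_mult[OF e] spec_mat_one[OF e])
  then have "v = spec_mat e (\<lambda>j. Z / exp (h j)) *v (spec_mat e (\<lambda>j. exp (h j) / Z) *v v)" for v
    by (simp add: matrix_vector_mul_assoc)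
  then have inj: "v = 0" if "spec_mat e (\<lambda>j. exp (h j) / Z) *v v = 0" for v
    using that by (metis matrix_vector_mult_0_right)
  have ker: "mat_kernel (corner_gibbs (mat 1) H) \<subseteq> mat_kernel \<rho>"
    unfolding mat_kernel_def G using inj by (auto dest!: inj)
  have "mat_log (corner_gibbs (mat 1) H) = spec_mat e (\<lambda>j. h j - ln Z * 1)"
    unfolding G mat_log_spec_mat[OF e] using Z by (simp add: ln_div)
  also have "\<dots> = H - ln Z *\<^sub>R mat 1"
    by (simp only: spec_mat_diff spec_mat_scaleR spec_mat_one[OF e] h)
  finally have log: "mat_log (corner_gibbs (mat 1) H) = H - ln Z *\<^sub>R mat 1" .
  have "hs_prod \<rho> (mat 1) = 1"
    using \<rho> by (simp add: hs_prod_def states_def)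
  then have "hs_prod \<rho> (mat_log \<rho> - mat_log (corner_gibbs (mat 1) H)) = ln Z - hs_prod H \<rho> - vn_entropy \<rho>"
    by (simp add: log linear_diff[OF linear_hs_prod] linear_scale[OF linear_hs_prod] hs_prod_commute[of H])
      (simp add: hs_prod_def vn_entropy_def)
  then show ?thesis
    using ker by (simp add: rel_entropy_def hs_prod_def Z_def)
qed

text \<open>Strong duality up to a slack: the point at height \<open>vn_entropy \<tau> + d\<close>
  lies outside the closed convex image of the hypograph. With \<open>d = 0\<close> an optimal
  \<open>H\<close> would be needed, which would make \<tau> an invertible Gibbs state.\<close>

lemma max_entropy_dual:
  fixes B :: "'r::finite \<Rightarrow> complex^'n^'n"
  assumes B: "\<And>i. hermitian (B i)" and \<tau>: "\<tau> \<in> states"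
    and max: "\<And>\<sigma>. \<sigma> \<in> states \<Longrightarrow> expect B \<sigma> = expect B \<tau> \<Longrightarrow> vn_entropy \<sigma> \<le> vn_entropy \<tau>"
    and d: "d > 0"
  shows "\<exists>H\<in>span (range B). ln (partition_fun (mat 1) H) - hs_prod H \<tau> < vn_entropy \<tau> + d"
proof -
  define C where "C = (\<lambda>x. (expect B (fst x), snd x)) ` entropy_hypograph"
  have CI: "(expect B \<sigma>, vn_entropy \<sigma>) \<in> C" if "\<sigma> \<in> states" for \<sigma>
    using imageI[of "(\<sigma>, vn_entropy \<sigma>)" entropy_hypograph "\<lambda>x. (expect B (fst x), snd x)"]
      that vn_entropy_nonneg[OF that]
    by (simp add: C_def entropy_hypograph_def)
  have "compact C"
    unfolding C_def
    by (intro compact_continuous_image compact_entropy_hypograph linear_continuous_on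
        linear_conv_bounded_linear[THEN iffD1] linear_expect_entropy)
  then have "closed C" by (rule compact_imp_closed)
  have "convex C"
    unfolding C_def by (intro convex_linear_image linear_expect_entropy convex_entropy_hypograph)
  have "(expect B \<tau>, vn_entropy \<tau> + d) \<notin> C"
  proof
    assume "(expect B \<tau>, vn_entropy \<tau> + d) \<in> C"
    then obtain \<sigma> where \<sigma>: "\<sigma> \<in> states" "expect B \<sigma> = expect B \<tau>" "vn_entropy \<tau> + d \<le> vn_entropy \<sigma>"
      by (auto simp: C_def entropy_hypograph_def)
    then show False using max[OF \<sigma>(1,2)] d by simp
  qed
  then obtain a b where a: "a \<bullet> (expect B \<tau>, vn_entropy \<tau> + d) < b" "\<And>y. y \<in> C \<Longrightarrow> b < a \<bullet> y"
    using separating_hyperplane_closed_point[OF \<open>convex C\<close> \<open>closed C\<close>] by metis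
  obtain h c where hc: "a = (h, c)" by (cases a)
  have sep: "h \<bullet> expect B \<tau> + c * (vn_entropy \<tau> + d) < h \<bullet> expect B \<sigma> + c * vn_entropy \<sigma>"
    if "\<sigma> \<in> states" for \<sigma>
    using a(1) a(2)[OF CI[OF that]] by (simp add: hc)
  \<comment> \<open>Testing the separation at \<tau> itself excludes a vertical hyperplane and fixes
    the sign.\<close>
  have "c * d < 0" using sep[OF \<tau>] by (simp add: algebra_simps)
  then have c: "c < 0" using d by (simp add: mult_less_0_iff)
  define H where "H = (\<Sum>i\<in>UNIV. ((h /\<^sub>R c) $ i) *\<^sub>R B i)"
  have H: "H \<in> span (range B)" unfolding H_def by (rule sum_in_span_range)
  have herm: "hermitian H" by (rule hermitian_span[OF B H])
  have hsH: "hs_prod H \<sigma> = (h \<bullet> expect B \<sigma>) / c" for \<sigma>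
    unfolding H_def inner_expect[symmetric] by (simp add: divide_inverse mult.commute)
  let ?G = "corner_gibbs (mat 1) H"
  have "?G \<in> states"
    using corner_gibbs_state(1)[OF mat_projection_mat_1 mat_1_neq_0 herm] by (simp add: corner_states_mat_1)
  from sep[OF this] have "(h \<bullet> expect B ?G + c * vn_entropy ?G) / c
      < (h \<bullet> expect B \<tau> + c * (vn_entropy \<tau> + d)) / c"
    using c by (rule divide_strict_right_mono_neg)
  then have "vn_entropy ?G + hs_prod H ?G < vn_entropy \<tau> + d + hs_prod H \<tau>"
    unfolding hsH using c by (simp add: add_divide_distrib)
  then have "ln (partition_fun (mat 1) H) - hs_prod H \<tau> < vn_entropy \<tau> + d"
    unfolding corner_gibbs_state(2)[OF mat_projection_mat_1 mat_1_neq_0 herm] by simp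
  then show ?thesis using H by blast
qed

text \<open>Apart from its own entropy, \<rho> enters the relative entropy to a Gibbs state only
  through its expectations, so there it may be replaced by its projection \<tau>. The variational
  principle bounds the infimum from below and \<open>max_entropy_dual\<close> from above.\<close>

lemma divergence_from_gibbs_family:
  assumes B: "\<And>i. hermitian (B i)" and \<rho>: "\<rho> \<in> states"
  shows "divergence_from (gibbs_family (span (range B))) \<rho>
    = ereal (vn_entropy (gibbs_projection B \<rho>) - vn_entropy \<rho>)"
proof -
  define \<tau> where "\<tau> = gibbs_projection B \<rho>"
  have \<tau>: "\<tau> \<in> states" "expect B \<tau> = expect B \<rho>"
    unfolding \<tau>_def by (intro gibbs_projection[OF B \<rho>])+
  have max: "vn_entropy \<sigma> \<le> vn_entropy \<tau>" if "\<sigma> \<in> states" "expect B \<sigma> = expect B \<tau>" for \<sigma>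
    unfolding \<tau>_def using that \<tau>(2) by (intro gibbs_projection_max_entropy[OF B \<rho>]) auto
  have rel: "rel_entropy \<rho> (corner_gibbs (mat 1) H)
      = ereal (ln (partition_fun (mat 1) H) - hs_prod H \<tau> - vn_entropy \<rho>)" if "H \<in> span (range B)" for H
    using rel_entropy_gibbs[OF \<rho> hermitian_span[OF B that]] hs_prod_span_cong[OF \<tau>(2) that] by simp
  have "(INF \<sigma>\<in>gibbs_family (span (range B)). rel_entropy \<rho> \<sigma>) = ereal (vn_entropy \<tau> - vn_entropy \<rho>)"
  proof (rule antisym)
    show "ereal (vn_entropy \<tau> - vn_entropy \<rho>) \<le> (INF \<sigma>\<in>gibbs_family (span (range B)). rel_entropy \<rho> \<sigma>)"
    proof (rule INF_greatest)
      fix \<sigma> assume "\<sigma> \<in> gibbs_family (span (range B))"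
      then obtain H where H: "H \<in> span (range B)" "\<sigma> = corner_gibbs (mat 1) H"
        by (auto simp: gibbs_family_eq)
      then show "ereal (vn_entropy \<tau> - vn_entropy \<rho>) \<le> rel_entropy \<rho> \<sigma>"
        using vn_entropy_le_log_partition[OF \<tau>(1) hermitian_span[OF B H(1)]] by (simp add: rel)
    qed
    show "(INF \<sigma>\<in>gibbs_family (span (range B)). rel_entropy \<rho> \<sigma>) \<le> ereal (vn_entropy \<tau> - vn_entropy \<rho>)"
    proof (rule ereal_le_epsilon2)
      fix d :: real assume d: "0 < d"
      obtain H where H: "H \<in> span (range B)" "ln (partition_fun (mat 1) H) - hs_prod H \<tau> < vn_entropy \<tau> + d"
        using max_entropy_dual[where B = B, OF B \<tau>(1) _ d] max by blast
      have "(INF \<sigma>\<in>gibbs_family (span (range B)). rel_entropy \<rho> \<sigma>) \<le> rel_entropy \<rho> (corner_gibbs (mat 1) H)"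
        using H by (intro INF_lower) (auto simp: gibbs_family_eq)
      also have "\<dots> \<le> ereal (vn_entropy \<tau> - vn_entropy \<rho>) + ereal d"
        using H by (simp add: rel)
      finally show "(INF \<sigma>\<in>gibbs_family (span (range B)). rel_entropy \<rho> \<sigma>)
          \<le> ereal (vn_entropy \<tau> - vn_entropy \<rho>) + ereal d" .
    qed
  qed
  then show ?thesis by (simp add: divergence_from_def \<tau>_def)
qed


section \<open>Pure states\<close>

definition pure_state :: "complex^'n \<Rightarrow> complex^'n^'n" where
  "pure_state v = (\<chi> x y. v $ x * cnj (v $ y))"

lemma pure_state_vec: "pure_state v *v u = cip v u *s v"
  by (simp add: vec_eq_iff pure_state_def matrix_vector_mult_def cip_def sum_distrib_left sum_distrib_right mult_ac)

lemma hermitian_pure_state: "hermitian (pure_state v)"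
  by (rule hermitianI) (simp add: pure_state_def)

lemma pure_state_in_states:
  assumes "norm v = 1"
  shows "pure_state v \<in> states"
proof (rule statesI[OF hermitian_pure_state])
  show "0 \<le> Re (cip u (pure_state v *v u))" for u
  proof -
    have "cip u (pure_state v *v u) = cip v u * cnj (cip v u)"
      by (simp add: pure_state_vec cip_smult_right cnj_cip)
    also have "\<dots> = of_real ((cmod (cip v u))\<^sup>2)"
      by (rule complex_norm_square[symmetric])
    finally show ?thesis by (simp only: Re_complex_of_real) simp
  qed
  have "trace (pure_state v) = cip v v"
    by (simp add: trace_def pure_state_def cip_def mult.commute)
  then show "trace (pure_state v) = 1"
    using assms by (simp add: cip_self)
qed

text \<open>Idempotence leaves only the eigenvalues 0 and 1, at which \<open>x * ln x\<close>
  vanishes.\<close>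

lemma vn_entropy_pure_state:
  assumes "norm v = 1"
  shows "vn_entropy (pure_state v) = 0"
proof -
  obtain e a where e: "orthonormal e" and a: "pure_state v = spec_mat e a"
    using hermitian_spectral[OF hermitian_pure_state] by blast
  have "cip v v = 1" using assms by (simp add: cip_self)
  then have "pure_state v ** pure_state v = pure_state v"
    by (simp add: matrix_eq matrix_vector_mul_assoc[symmetric] pure_state_vec cip_smult_right)
  then have "spec_mat e (\<lambda>j. a j * a j) = spec_mat e a"
    by (simp only: a spec_mat_mult[OF e])
  from spec_mat_inject[OF e this] have "a j = 0 \<or> a j = 1" for j
    by (metis mult_cancel_right1)
  then have *: "a j * ln (a j) = 0" for j
    by (metis ln_one mult_zero_left mult_zero_right)
  show ?thesis by (simp only: a vn_entropy_spec_mat[OF e] * sum.neutral_const minus_zero)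
qed

lemma continuous_on_pure_state: "continuous_on UNIV (pure_state :: complex^'n \<Rightarrow> complex^'n^'n)"
  unfolding pure_state_def by (intro continuous_on_vec_lambda continuous_intros)

lemma cip_axis: "cip (axis x 1) u = u $ x"
  by (simp add: cip_def axis_def if_distrib[of cnj] if_distrib[of "\<lambda>z. z * _"] cong: if_cong)

text \<open>A vanishing diagonal entry puts a unit vector into the kernel, which clears its column
  and, by hermiticity, its row.\<close>

lemma state_diagonal:
  assumes "\<sigma> \<in> states"
  shows "0 \<le> Re (\<sigma> $ x $ x)" and "Re (\<sigma> $ x $ x) = 0 \<Longrightarrow> \<sigma> $ y $ x = 0"
    and "Re (\<sigma> $ x $ x) = 0 \<Longrightarrow> \<sigma> $ x $ y = 0"
proof -
  have col: "(\<sigma> *v axis x 1) $ y = \<sigma> $ y $ x" for y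
    by (simp add: matrix_vector_mult_def axis_def if_distrib[of "\<lambda>z. _ * z"] cong: if_cong)
  have q: "cip (axis x 1) (\<sigma> *v axis x 1) = \<sigma> $ x $ x"
    by (simp add: cip_axis col)
  show "0 \<le> Re (\<sigma> $ x $ x)"
    using state_quadratic_form_nonneg[OF assms, of "axis x 1"] by (simp only: q)
  show *: "\<sigma> $ y $ x = 0" if "Re (\<sigma> $ x $ x) = 0" for y
    using state_kernel[OF assms, of "axis x 1"] that by (simp add: q col[symmetric])
  show "\<sigma> $ x $ y = 0" if "Re (\<sigma> $ x $ x) = 0"
    using *[OF that, of y] hermitian_nth[OF state_hermitian[OF assms], of x y] by simp
qed

text \<open>For Hermitian \<open>M\<close> the product is the squared Frobenius norm.\<close>

lemma hermitian_eq_0I: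
  assumes "hermitian M" "hs_prod M M = 0"
  shows "M = 0"
proof -
  have "M $ i $ j * M $ j $ i = of_real ((cmod (M $ i $ j))\<^sup>2)" for i j
    by (subst (2) hermitian_nth[OF assms(1)]) (rule complex_norm_square[symmetric])
  then have "hs_prod M M = (\<Sum>i\<in>UNIV. \<Sum>j\<in>UNIV. (cmod (M $ i $ j))\<^sup>2)"
    by (simp add: hs_prod_def trace_def matrix_matrix_mult_def del: of_real_power)
  then have "(\<Sum>j\<in>UNIV. (cmod (M $ i $ j))\<^sup>2) = 0" for i
    using assms(2) sum_nonneg_eq_0_iff[of UNIV "\<lambda>i. \<Sum>j\<in>UNIV. (cmod (M $ i $ j))\<^sup>2"]
    by (simp add: sum_nonneg)
  then have "(cmod (M $ i $ j))\<^sup>2 = 0" for i j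
    using sum_nonneg_eq_0_iff[of UNIV "\<lambda>j. (cmod (M $ i $ j))\<^sup>2"] by simp
  then show ?thesis by (simp add: vec_eq_iff)
qed

section \<open>Local Hamiltonians and marginals\<close>

lemma hermitian_local_term:
  assumes "h \<in> local_terms k"
  shows "hermitian h"
proof -
  obtain A b where h: "h = amplify A b"
    and b: "\<forall>x \<in> A \<rightarrow>\<^sub>E UNIV. \<forall>y \<in> A \<rightarrow>\<^sub>E UNIV. b x y = cnj (b y x)"
    using assms by (auto simp: local_terms_def)
  have "b (restrict x A) (restrict y A) = cnj (b (restrict y A) (restrict x A))" for x y :: "3 \<Rightarrow> 2"
    by (intro b[rule_format]) auto
  note sym = this
  have "amplify A b $ x $ y = cnj (amplify A b $ y $ x)" for x y
    unfolding amplify_def vec_lambda_beta using sym[of x y] by auto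
  then show ?thesis
    unfolding h by (rule hermitianI)
qed

lemma hermitian_local_hamiltonian:
  assumes "h \<in> local_hamiltonians k"
  shows "hermitian h"
proof -
  have "hermitian (sum_list hs)" if "set hs \<subseteq> local_terms k" for hs
    using that by (induction hs) (auto intro: hermitian_0 hermitian_add hermitian_local_term)
  then show ?thesis using assms by (auto simp: local_hamiltonians_def)
qed

lemma local_term_in_local_hamiltonians: "h \<in> local_terms k \<Longrightarrow> h \<in> local_hamiltonians k"
  unfolding local_hamiltonians_def by (rule CollectI, rule exI[of _ "[h]"]) simp

lemma local_hamiltonians_3: "local_hamiltonians 3 = {H. hermitian H}"
proof (intro subset_antisym subsetI CollectI)
  fix H :: three_qubit_op
  assume "H \<in> {H. hermitian H}"
  then have "hermitian H" by simp
  then have H: "H $ x $ y = cnj (H $ y $ x)" for x y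
    by (rule hermitian_nth)
  have "amplify UNIV (\<lambda>x y. H $ x $ y) \<in> local_terms 3"
  proof -
    have "card (UNIV :: 3 set) \<le> 3" by simp
    moreover have "\<forall>x\<in>UNIV \<rightarrow>\<^sub>E UNIV. \<forall>y\<in>UNIV \<rightarrow>\<^sub>E UNIV. H $ x $ y = cnj (H $ y $ x)"
      by (intro ballI) (rule H)
    ultimately show ?thesis
      unfolding local_terms_def mem_Collect_eq
      by (intro exI[of _ UNIV] exI[of _ "\<lambda>x y. H $ x $ y"] conjI refl)
  qed
  moreover have "amplify UNIV (\<lambda>x y. H $ x $ y) = H"
    by (simp add: amplify_def vec_eq_iff restrict_UNIV)
  ultimately show "H \<in> local_hamiltonians 3"
    using local_term_in_local_hamiltonians by metis
qed (rule hermitian_local_hamiltonian)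

text \<open>Every Hermitian matrix is an admissible observable, in particular the difference
  \<open>M\<close> of the two states, which is tested against itself.\<close>

lemma gibbs_projection_3_local:
  fixes B3 :: "'s::finite \<Rightarrow> three_qubit_op"
  assumes B3: "span (range B3) = local_hamiltonians 3" and \<rho>: "\<rho> \<in> states"
  shows "gibbs_projection B3 \<rho> = \<rho>"
proof -
  have herm: "hermitian (B3 i)" for i
    using B3 span_base[of "B3 i" "range B3"] by (simp add: local_hamiltonians_3)
  define M where "M = gibbs_projection B3 \<rho> - \<rho>"
  have M: "hermitian M"
    unfolding M_def by (intro hermitian_diff state_hermitian \<rho> gibbs_projection herm)
  then have "M \<in> span (range B3)" by (simp add: B3 local_hamiltonians_3)
  then have "hs_prod M (gibbs_projection B3 \<rho>) = hs_prod M \<rho>"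
    by (intro hs_prod_span_cong[where B = B3] gibbs_projection(2) herm \<rho>)
  moreover have "hs_prod M M = hs_prod M (gibbs_projection B3 \<rho>) - hs_prod M \<rho>"
    by (subst (2) M_def) (rule linear_diff[OF linear_hs_prod])
  ultimately have "hs_prod M M = 0" by simp
  then show ?thesis
    using hermitian_eq_0I[OF M] by (simp add: M_def)
qed

lemma sum_pick:
  fixes f :: "'a::finite \<Rightarrow> 'b::finite \<Rightarrow> complex"
  shows "(\<Sum>x\<in>UNIV. \<Sum>y\<in>UNIV. if x = a \<and> y = b then f x y else 0) = f a b"
proof -
  have "(\<Sum>y\<in>UNIV. if x = a \<and> y = b then f x y else 0) = (if x = a then f a b else 0)" for x
    by auto
  then show ?thesis by simp
qed

text \<open>The sum is a matrix entry of the partial trace of \<open>M\<close> over site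
  \<open>i\<close>, indexed by the restrictions of \<open>r\<close> and \<open>s\<close> to the
  other two sites.\<close>

lemma marginal_eq_0:
  assumes M: "hermitian M" and loc: "\<And>h. h \<in> local_terms 2 \<Longrightarrow> hs_prod h M = 0"
  shows "(\<Sum>c\<in>UNIV. M $ (r(i := c)) $ (s(i := c))) = 0"
proof -
  define T where "T = (\<Sum>c\<in>UNIV. M $ (r(i := c)) $ (s(i := c)))"
  define A :: "3 set" where "A = - {i}"
  have "card A = 2"
    unfolding A_def Compl_eq_Diff_UNIV by (subst card_Diff_singleton) simp_all
  define R S where "R = restrict r A" and "S = restrict s A"
  \<comment> \<open>The coefficients are chosen so that pairing with \<open>M\<close> gives twice
    the squared modulus of \<open>T\<close>: one Hermitian test settles real and imaginary part
    together. Adding the two summands also covers \<open>R = S\<close>.\<close>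
  define b where "b = (\<lambda>x y. (if x = S \<and> y = R then cnj T else 0) + (if x = R \<and> y = S then T else 0))"
  have "amplify A b \<in> local_terms 2"
  proof -
    have "(if p \<and> q then cnj u else 0) + (if p' \<and> q' then u else 0)
        = cnj ((if q' \<and> p' then cnj u else 0) + (if q \<and> p then u else 0))" for p q p' q' and u :: complex
      by auto
    then have "b x y = cnj (b y x)" for x y unfolding b_def .
    then have "\<forall>x\<in>A \<rightarrow>\<^sub>E UNIV. \<forall>y\<in>A \<rightarrow>\<^sub>E UNIV. b x y = cnj (b y x)" by (intro ballI)
    moreover have "card A \<le> 2" by (simp add: \<open>card A = 2\<close>)
    ultimately show ?thesis
      unfolding local_terms_def mem_Collect_eq
      by (intro exI[of _ A] exI[of _ b] conjI refl)
  qed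
  then have 0: "hs_prod (amplify A b) M = 0" by (rule loc)
  have res: "restrict x A = restrict u A \<longleftrightarrow> x = u(i := x i)" for x u :: "3 \<Rightarrow> 2"
  proof -
    have "restrict x A = restrict u A \<longleftrightarrow> (\<forall>j. j \<noteq> i \<longrightarrow> x j = u j)"
      by (auto simp: A_def fun_eq_iff restrict_def)
    also have "\<dots> \<longleftrightarrow> x = u(i := x i)"
      unfolding fun_eq_iff fun_upd_apply by metis
    finally show ?thesis .
  qed
  \<comment> \<open>Pairs of configurations that are prescribed off \<open>i\<close> and agree at
    \<open>i\<close> are parametrized by their common value there.\<close>
  have pick: "(\<Sum>x\<in>UNIV. \<Sum>y\<in>UNIV. if x i = y i \<and> restrict x A = restrict u A \<and> restrict y A = restrict w A
      then f x y else 0) = (\<Sum>c\<in>UNIV. f (u(i := c)) (w(i := c)))"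
    for u w :: "3 \<Rightarrow> 2" and f :: "(3 \<Rightarrow> 2) \<Rightarrow> (3 \<Rightarrow> 2) \<Rightarrow> complex"
  proof -
    have "(if x i = y i \<and> restrict x A = restrict u A \<and> restrict y A = restrict w A then f x y else 0)
        = (\<Sum>c\<in>UNIV. if x = u(i := c) \<and> y = w(i := c) then f x y else 0)" for x y
    proof -
      have "x = u(i := c) \<and> y = w(i := c) \<longleftrightarrow>
          c = x i \<and> x i = y i \<and> restrict x A = restrict u A \<and> restrict y A = restrict w A" for c
        unfolding res by (metis fun_upd_same)
      moreover have "(\<Sum>c\<in>UNIV. if c = x i \<and> Q then z else 0) = (if Q then z else 0)" for Q and z :: complex
        by (cases Q) simp_all
      ultimately show ?thesis by (simp only:)
    qed
    note expand = this
    have "(\<Sum>x\<in>UNIV. \<Sum>y\<in>UNIV. if x i = y i \<and> restrict x A = restrict u A \<and> restrict y A = restrict w A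
        then f x y else 0)
        = (\<Sum>x\<in>UNIV. \<Sum>y\<in>UNIV. \<Sum>c\<in>UNIV. if x = u(i := c) \<and> y = w(i := c) then f x y else 0)"
      by (intro sum.cong refl expand)
    also have "\<dots> = (\<Sum>x\<in>UNIV. \<Sum>c\<in>UNIV. \<Sum>y\<in>UNIV. if x = u(i := c) \<and> y = w(i := c) then f x y else 0)"
      by (intro sum.cong refl sum.swap)
    also have "\<dots> = (\<Sum>c\<in>UNIV. \<Sum>x\<in>UNIV. \<Sum>y\<in>UNIV. if x = u(i := c) \<and> y = w(i := c) then f x y else 0)"
      by (rule sum.swap)
    finally show ?thesis by (simp only: sum_pick)
  qed
  have agree: "(\<forall>j. j \<notin> A \<longrightarrow> x j = y j) \<longleftrightarrow> x i = y i" for x y :: "3 \<Rightarrow> 2"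
    by (simp add: A_def)
  have "amplify A b $ x $ y * M $ y $ x =
      (if x i = y i \<and> restrict x A = S \<and> restrict y A = R then cnj T * M $ y $ x else 0)
      + (if x i = y i \<and> restrict x A = R \<and> restrict y A = S then T * M $ y $ x else 0)" for x y
  proof -
    have "(if p then (if q then u else 0) + (if q' then w else 0) else 0) * m
        = (if p \<and> q then u * m else 0) + (if p \<and> q' then w * m else 0)" for p q q' and u w m :: complex
      by (simp add: distrib_right)
    then show ?thesis
      unfolding amplify_def vec_lambda_beta agree b_def .
  qed
  note entry = this[unfolded R_def S_def]
  then have "trace (amplify A b ** M) =
      (\<Sum>c\<in>UNIV. cnj T * M $ (r(i := c)) $ (s(i := c))) + (\<Sum>c\<in>UNIV. T * M $ (s(i := c)) $ (r(i := c)))"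
    by (simp only: trace_def matrix_matrix_mult_def vec_lambda_beta entry sum.distrib pick)
  also have "\<dots> = cnj T * T + T * cnj T"
  proof -
    have "(\<Sum>c\<in>UNIV. M $ (s(i := c)) $ (r(i := c))) = cnj T"
      unfolding T_def cnj_sum by (intro sum.cong refl hermitian_nth[OF M])
    then show ?thesis by (simp add: sum_distrib_left[symmetric] T_def[symmetric])
  qed
  also have "\<dots> = of_real (2 * (cmod T)\<^sup>2)"
    unfolding mult_2 of_real_add complex_norm_square by (simp only: mult.commute)
  finally have "2 * (cmod T)\<^sup>2 = 0" using 0 by (simp only: hs_prod_def Re_complex_of_real)
  then show ?thesis by (simp add: T_def)
qed

section \<open>Three qubits near the GHZ state\<close>

text \<open>The sites are called 1, 2 and 3, where the numeral 3 denotes 0 in the type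
  \<open>3\<close>; bits are 0 and 1.\<close>

definition cfg :: "2 \<Rightarrow> 2 \<Rightarrow> 2 \<Rightarrow> 3 \<Rightarrow> 2" where
  "cfg a b c = (\<lambda>i. if i = 1 then a else if i = 2 then b else c)"

lemma cfg_upd [simp]:
  "(cfg a b c)(1 := d) = cfg d b c" "(cfg a b c)(2 := d) = cfg a d c" "(cfg a b c)(3 := d) = cfg a b d"
  using exhaust_3 by (auto simp: cfg_def fun_eq_iff)

lemma cfg_eq_iff [simp]: "cfg a b c = cfg a' b' c' \<longleftrightarrow> a = a' \<and> b = b' \<and> c = c'"
  by (auto simp: cfg_def fun_eq_iff forall_3)

lemma cfg_cases: "\<exists>a b c. x = cfg a b c"
  by (rule exI[of _ "x 1"], rule exI[of _ "x 2"], rule exI[of _ "x 3"])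
    (use exhaust_3 in \<open>auto simp: cfg_def fun_eq_iff\<close>)

lemma bit_cases: "(c :: 2) = 0 \<or> c = 1"
  using exhaust_2[of c] by auto

lemma UNIV_2_01: "(UNIV :: 2 set) = {0, 1}"
  using bit_cases by auto

lemma sum_2_01: "(\<Sum>c\<in>(UNIV :: 2 set). f c) = f 0 + f 1"
  by (simp add: UNIV_2_01)

text \<open>Not normalized. The values 1 and -1 of \<open>s\<close> give the two GHZ vectors;
  \<open>t\<close> is the perturbation that makes the state visible to its marginals.\<close>

definition ghz_vec :: "real \<Rightarrow> real \<Rightarrow> complex^(3 \<Rightarrow> 2)" where
  "ghz_vec s t = axis (cfg 0 0 0) 1 + s *\<^sub>R axis (cfg 1 1 1) 1 + t *\<^sub>R axis (cfg 1 1 0) 1"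

lemma ghz_vec_nth:
  "ghz_vec s t $ x = of_real (if x = cfg 0 0 0 then 1 else if x = cfg 1 1 1 then s else if x = cfg 1 1 0 then t else 0)"
  by (simp add: ghz_vec_def axis_def scaleR_conv_of_real[where 'a=complex])

lemma ghz_vec_neq_0: "ghz_vec s t \<noteq> 0"
proof
  assume "ghz_vec s t = 0"
  then have "ghz_vec s t $ cfg 0 0 0 = 0" by simp
  then show False by (simp add: ghz_vec_nth)
qed

definition ghz_state :: "real \<Rightarrow> real \<Rightarrow> three_qubit_op" where
  "ghz_state s t = pure_state (ghz_vec s t /\<^sub>R norm (ghz_vec s t))"

lemma norm_ghz: "norm (ghz_vec s t /\<^sub>R norm (ghz_vec s t)) = 1"
  by (simp add: ghz_vec_neq_0)

lemma ghz_state_nth: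
  "ghz_state s t $ x $ y = of_real (inverse ((norm (ghz_vec s t))\<^sup>2)) * (ghz_vec s t $ x * ghz_vec s t $ y)"
proof -
  have "cnj (ghz_vec s t $ y) = ghz_vec s t $ y" by (simp add: ghz_vec_nth)
  then show ?thesis
    by (simp add: ghz_state_def pure_state_def scaleR_conv_of_real[where 'a=complex] power2_eq_square mult_ac)
qed

lemma ghz_state_in_states: "ghz_state s t \<in> states"
  unfolding ghz_state_def by (rule pure_state_in_states[OF norm_ghz])

lemma vn_entropy_ghz_state: "vn_entropy (ghz_state s t) = 0"
  unfolding ghz_state_def by (rule vn_entropy_pure_state[OF norm_ghz])

lemma tendsto_ghz_state: "(\<lambda>n. ghz_state 1 (1 / real (Suc n))) \<longlonglongrightarrow> ghz_state 1 0"
proof -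
  have t: "(\<lambda>n. 1 / real (Suc n)) \<longlonglongrightarrow> 0"
    by (rule LIMSEQ_Suc) (rule lim_1_over_n)
  have g: "(\<lambda>n. ghz_vec 1 (1 / real (Suc n))) \<longlonglongrightarrow> ghz_vec 1 0"
    unfolding ghz_vec_def by (intro tendsto_intros t)
  have "(\<lambda>n. ghz_vec 1 (1 / real (Suc n)) /\<^sub>R norm (ghz_vec 1 (1 / real (Suc n))))
      \<longlonglongrightarrow> ghz_vec 1 0 /\<^sub>R norm (ghz_vec 1 0)"
    by (intro tendsto_intros g) (simp add: ghz_vec_neq_0)
  then show ?thesis
    unfolding ghz_state_def
    by (rule continuous_on_tendsto_compose[OF continuous_on_pure_state]) auto
qed

text \<open>A local term on fewer than three sites has no matrix element between \<open>000\<close> and \<open>111\<close>, so it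
  does not see the phase between them.\<close>

lemma ghz_phase_invisible:
  assumes "h \<in> local_terms 2"
  shows "hs_prod h (ghz_state 1 0) = hs_prod h (ghz_state (-1) 0)"
proof -
  obtain A b where h: "h = amplify A b" and A: "card A \<le> 2"
    using assms by (auto simp: local_terms_def)
  have "A \<noteq> UNIV"
    using A by auto
  then obtain i where i: "i \<notin> A" by blast
  have n: "norm (ghz_vec (-1) 0) = norm (ghz_vec 1 0)"
    unfolding norm_vec_def by (rule arg_cong[of _ _ "\<lambda>f. L2_set f UNIV"]) (auto simp: fun_eq_iff ghz_vec_nth)
  have 0: "h $ x $ y = 0" if "x = cfg 0 0 0 \<and> y = cfg 1 1 1 \<or> x = cfg 1 1 1 \<and> y = cfg 0 0 0" for x y
  proof -
    have "cfg 0 0 0 i \<noteq> cfg 1 1 1 i" by (simp add: cfg_def)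
    then have "x i \<noteq> y i" using that by auto
    then show ?thesis using i by (auto simp: h amplify_def)
  qed
  have *: "h $ x $ y * ghz_state 1 0 $ y $ x = h $ x $ y * ghz_state (-1) 0 $ y $ x" for x y
    using 0[of x y] by (auto simp: ghz_state_nth n ghz_vec_nth)
  show ?thesis
    by (simp only: hs_prod_def trace_def matrix_matrix_mult_def vec_lambda_beta *)
qed

text \<open>The coherence between 000 and 111 has opposite signs.\<close>

lemma ghz_state_neq: "ghz_state 1 0 \<noteq> ghz_state (-1) 0"
proof
  assume "ghz_state 1 0 = ghz_state (-1) 0"
  then have "Re (ghz_state 1 0 $ cfg 0 0 0 $ cfg 1 1 1) = Re (ghz_state (-1) 0 $ cfg 0 0 0 $ cfg 1 1 1)"
    by simp
  moreover have "Re (ghz_state 1 0 $ cfg 0 0 0 $ cfg 1 1 1) > 0"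
    by (simp add: ghz_state_nth ghz_vec_nth ghz_vec_neq_0)
  moreover have "Re (ghz_state (-1) 0 $ cfg 0 0 0 $ cfg 1 1 1) < 0"
    by (simp add: ghz_state_nth ghz_vec_nth ghz_vec_neq_0)
  ultimately show False by simp
qed

text \<open>The marginals confine a state to the span of \<open>000\<close>, \<open>110\<close>, \<open>111\<close> and fix all matrix
  elements except the one between \<open>000\<close> and \<open>111\<close>. The latter is fixed by positivity: the vector
  \<open>|110\<rangle> - t |111\<rangle>\<close> lies in the kernel.\<close>

lemma ghz_state_determined:
  assumes t: "t \<noteq> 0" and \<sigma>: "\<sigma> \<in> states"
    and loc: "\<And>h. h \<in> local_terms 2 \<Longrightarrow> hs_prod h \<sigma> = hs_prod h (ghz_state 1 t)"
  shows "\<sigma> = ghz_state 1 t"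
proof -
  let ?P = "ghz_state 1 t"
  note P = ghz_state_in_states[of 1 t]
  have "(\<Sum>c\<in>UNIV. (\<sigma> - ?P) $ (r(i := c)) $ (s(i := c))) = 0" for r s i
    by (rule marginal_eq_0)
      (simp_all add: hermitian_diff state_hermitian \<sigma> P linear_diff[OF linear_hs_prod] loc)
  then have marg: "\<sigma> $ (r(i := 0)) $ (s(i := 0)) + \<sigma> $ (r(i := 1)) $ (s(i := 1))
      = ?P $ (r(i := 0)) $ (s(i := 0)) + ?P $ (r(i := 1)) $ (s(i := 1))" for r s i
    by (simp add: sum_2_01 algebra_simps)
  have P0: "?P $ x $ y = 0" if "x \<notin> {cfg 0 0 0, cfg 1 1 0, cfg 1 1 1} \<or> y \<notin> {cfg 0 0 0, cfg 1 1 0, cfg 1 1 1}" for x y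
    using that by (auto simp: ghz_state_nth ghz_vec_nth)
  note pos = state_diagonal(1)[OF \<sigma>]
  have zero: "Re (\<sigma> $ x $ x) = 0 \<and> Re (\<sigma> $ y $ y) = 0"
    if "\<sigma> $ x $ x + \<sigma> $ y $ y = 0" for x y
    using arg_cong[OF that, of Re] pos[of x] pos[of y] by simp
  \<comment> \<open>A vanishing diagonal entry of a marginal is a sum of two nonnegative diagonal
    entries of \<sigma>, so both are 0. In \<open>?P\<close> the sites 1 and 2 carry only 00 and 11,
    and the sites 1 and 3 never carry 01.\<close>
  have d01: "Re (\<sigma> $ cfg 0 1 c $ cfg 0 1 c) = 0" for c
    using marg[of "cfg 0 1 0" 3 "cfg 0 1 0"] zero bit_cases[of c] by (auto simp: P0)
  have d10: "Re (\<sigma> $ cfg 1 0 c $ cfg 1 0 c) = 0" for c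
    using marg[of "cfg 1 0 0" 3 "cfg 1 0 0"] zero bit_cases[of c] by (auto simp: P0)
  have d001: "Re (\<sigma> $ cfg 0 0 1 $ cfg 0 0 1) = 0"
    using marg[of "cfg 0 0 1" 2 "cfg 0 0 1"] zero by (auto simp: P0)
  have \<sigma>0: "\<sigma> $ x $ y = 0" if "x \<notin> {cfg 0 0 0, cfg 1 1 0, cfg 1 1 1} \<or> y \<notin> {cfg 0 0 0, cfg 1 1 0, cfg 1 1 1}" for x y
  proof -
    have "Re (\<sigma> $ z $ z) = 0" if z: "z \<notin> {cfg 0 0 0, cfg 1 1 0, cfg 1 1 1}" for z
    proof -
      obtain a b c where "z = cfg a b c" using cfg_cases by blast
      then show ?thesis
        using z bit_cases[of a] bit_cases[of b] bit_cases[of c] d01 d10 d001 by auto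
    qed
    then show ?thesis using that state_diagonal(2,3)[OF \<sigma>] by blast
  qed
  \<comment> \<open>In each marginal entry used here one of the two summands involves a
    configuration outside the support, so the marginal reads off a single entry of \<sigma>.\<close>
  have e00: "\<sigma> $ cfg 0 0 0 $ cfg 0 0 0 = ?P $ cfg 0 0 0 $ cfg 0 0 0"
    using marg[of "cfg 0 0 0" 2 "cfg 0 0 0"] by (simp add: P0 \<sigma>0)
  have e11: "\<sigma> $ cfg 1 1 a $ cfg 1 1 c = ?P $ cfg 1 1 a $ cfg 1 1 c" for a c
    using marg[of "cfg 1 0 a" 2 "cfg 1 0 c"] by (simp add: P0 \<sigma>0)
  have e01: "\<sigma> $ cfg 0 0 0 $ cfg 1 1 0 = ?P $ cfg 0 0 0 $ cfg 1 1 0"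
    using marg[of "cfg 0 0 0" 3 "cfg 1 1 0"] by (simp add: P0 \<sigma>0)
  define k :: "complex^(3 \<Rightarrow> 2)" where "k = axis (cfg 1 1 0) 1 - t *\<^sub>R axis (cfg 1 1 1) 1"
  have mk: "(A *v k) $ x = A $ x $ cfg 1 1 0 - of_real t * A $ x $ cfg 1 1 1" for A :: three_qubit_op and x
    unfolding k_def matrix_vector_mult_diff_distrib scaleR_conv_vector_scalar vec.scale
    by (simp add: matrix_vector_mult_def axis_def if_distrib[of "\<lambda>z. _ * z"] cong: if_cong)
  have ck: "cip k u = u $ cfg 1 1 0 - of_real t * u $ cfg 1 1 1" for u
    unfolding k_def cnj_cip[of u, symmetric] cip_diff_right scaleR_conv_vector_scalar cip_smult_right
    by (simp add: cnj_cip cip_axis)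
  have Pk: "(?P *v k) $ x = 0" for x
    by (simp add: mk ghz_state_nth ghz_vec_nth)
  \<comment> \<open>The form at \<open>k\<close> involves only the block of 110 and 111, where
    \<sigma> and \<open>?P\<close> agree; it is therefore 0, and positivity puts \<open>k\<close>
    into the kernel of \<sigma>.\<close>
  have "cip k (\<sigma> *v k) = cip k (?P *v k)"
    unfolding ck mk e11 ..
  then have "\<sigma> *v k = 0"
    using Pk by (intro state_kernel[OF \<sigma>]) (simp add: ck)
  then have "(\<sigma> *v k) $ cfg 0 0 0 = (?P *v k) $ cfg 0 0 0" using Pk by simp
  \<comment> \<open>Row 000 of the kernel equation expresses \<open>t\<close> times this entry by
    the known entry \<open>e01\<close>. For \<open>t = 0\<close> it would say nothing about
    it.\<close>
  then have e02: "\<sigma> $ cfg 0 0 0 $ cfg 1 1 1 = ?P $ cfg 0 0 0 $ cfg 1 1 1"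
    using t by (simp add: mk e01)
  have sym: "\<sigma> $ y $ x = ?P $ y $ x" if "\<sigma> $ x $ y = ?P $ x $ y" for x y
    using that hermitian_nth[OF state_hermitian[OF \<sigma>], of y x] hermitian_nth[OF state_hermitian[OF P], of y x]
    by simp
  have "\<sigma> $ x $ y = ?P $ x $ y" for x y
  proof (cases "x \<in> {cfg 0 0 0, cfg 1 1 0, cfg 1 1 1} \<and> y \<in> {cfg 0 0 0, cfg 1 1 0, cfg 1 1 1}")
    case True
    then show ?thesis by (auto simp: e00 e11 e01 e02 sym[OF e01] sym[OF e02])
  next
    case False
    then show ?thesis using P0[of x y] \<sigma>0[of x y] by auto
  qed
  then show ?thesis by (simp add: vec_eq_iff)
qed

text \<open>Trades the arbitrary basis for the local terms, with which the qubit states are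
  compared.\<close>

lemma expect_eq_iff:
  fixes B2 :: "'r::finite \<Rightarrow> three_qubit_op"
  assumes B2: "span (range B2) = local_hamiltonians k"
  shows "expect B2 \<sigma> = expect B2 \<tau> \<longleftrightarrow> (\<forall>h\<in>local_terms k. hs_prod h \<sigma> = hs_prod h \<tau>)"
proof
  assume eq: "expect B2 \<sigma> = expect B2 \<tau>"
  show "\<forall>h\<in>local_terms k. hs_prod h \<sigma> = hs_prod h \<tau>"
    by (intro ballI hs_prod_span_cong[OF eq]) (simp add: B2 local_term_in_local_hamiltonians)
next
  assume eq: "\<forall>h\<in>local_terms k. hs_prod h \<sigma> = hs_prod h \<tau>"
  have "hs_prod (sum_list hs) \<sigma> = hs_prod (sum_list hs) \<tau>" if "set hs \<subseteq> local_terms k" for hs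
    using that eq by (induction hs) (auto simp: linear_0[OF linear_hs_prod_left] linear_add[OF linear_hs_prod_left])
  then have "hs_prod h \<sigma> = hs_prod h \<tau>" if "h \<in> local_hamiltonians k" for h
    using that by (auto simp: local_hamiltonians_def)
  moreover have "B2 i \<in> local_hamiltonians k" for i
    unfolding B2[symmetric] by (intro span_base) auto
  ultimately show "expect B2 \<sigma> = expect B2 \<tau>"
    by (simp add: expect_def vec_eq_iff)
qed

theorem mainTheorem2:
  fixes B2 :: "'r::finite \<Rightarrow> three_qubit_op" and B3 :: "'s::finite \<Rightarrow> three_qubit_op"
  assumes "basis_of B2 (local_hamiltonians 2)" and "basis_of B3 (local_hamiltonians 3)"
  shows "(\<forall>\<rho>\<in>states. divergence_from (gibbs_family (local_hamiltonians 2)) \<rho>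
                       = ereal (irreducible_correlation3 B2 B3 \<rho>)) \<and>
         (\<exists>\<sigma>\<in>states. \<not> continuous (at \<sigma> within states) (irreducible_correlation3 B2 B3))"
proof -
  have B2: "span (range B2) = local_hamiltonians 2" and B3: "span (range B3) = local_hamiltonians 3"
    using assms by (auto simp: basis_of_def)
  have herm: "hermitian (B2 i)" for i
    by (rule hermitian_local_hamiltonian[of _ 2]) (auto simp: B2[symmetric] intro: span_base)
  let ?C = "irreducible_correlation3 B2 B3"
  have C: "?C \<rho> = vn_entropy (gibbs_projection B2 \<rho>) - vn_entropy \<rho>" if "\<rho> \<in> states" for \<rho>
    by (simp add: irreducible_correlation3_def gibbs_projection_3_local[OF B3 that])
  have "divergence_from (gibbs_family (local_hamiltonians 2)) \<rho> = ereal (?C \<rho>)" if "\<rho> \<in> states" for \<rho>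
    using divergence_from_gibbs_family[where B = B2, OF herm that] by (simp add: C[OF that] B2)
  moreover have "\<not> continuous (at (ghz_state 1 0) within states) ?C"
  proof
    assume cont: "continuous (at (ghz_state 1 0) within states) ?C"
    have "(?C \<circ> (\<lambda>n. ghz_state 1 (1 / real (Suc n)))) \<longlonglongrightarrow> ?C (ghz_state 1 0)"
      by (rule cont[unfolded continuous_within_sequentially, rule_format])
        (intro conjI allI ghz_state_in_states tendsto_ghz_state)
    \<comment> \<open>The fibre of a perturbed state is a single pure state, so the projection fixes
      it.\<close>
    moreover have "?C (ghz_state 1 (1 / real (Suc n))) = 0" for n
    proof -
      let ?t = "1 / real (Suc n)"
      have "gibbs_projection B2 (ghz_state 1 ?t) = ghz_state 1 ?t"
      proof (rule ghz_state_determined)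
        show "gibbs_projection B2 (ghz_state 1 ?t) \<in> states"
          by (intro gibbs_projection herm ghz_state_in_states)
        have "expect B2 (gibbs_projection B2 (ghz_state 1 ?t)) = expect B2 (ghz_state 1 ?t)"
          by (intro gibbs_projection herm ghz_state_in_states)
        then show "hs_prod h (gibbs_projection B2 (ghz_state 1 ?t)) = hs_prod h (ghz_state 1 ?t)"
          if "h \<in> local_terms 2" for h
          using that by (simp add: expect_eq_iff[OF B2])
      qed simp
      then show ?thesis by (simp add: C[OF ghz_state_in_states])
    qed
    ultimately have "?C (ghz_state 1 0) = 0"
      by (simp add: o_def LIMSEQ_const_iff)
    then have S0: "vn_entropy (gibbs_projection B2 (ghz_state 1 0)) = 0"
      by (simp add: C[OF ghz_state_in_states] vn_entropy_ghz_state)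
    \<comment> \<open>Both GHZ states have entropy 0, which continuity would make the maximum in
      their common fibre; uniqueness of the maximizer would then identify them.\<close>
    have "expect B2 (ghz_state (-1) 0) = expect B2 (ghz_state 1 0)"
      by (simp add: expect_eq_iff[OF B2] ghz_phase_invisible)
    then have "ghz_state (-1) 0 = gibbs_projection B2 (ghz_state 1 0)"
      by (intro gibbs_projection_max_entropy(2) herm ghz_state_in_states) (simp_all add: S0 vn_entropy_ghz_state)
    moreover have "ghz_state 1 0 = gibbs_projection B2 (ghz_state 1 0)"
      by (intro gibbs_projection_max_entropy(2) herm ghz_state_in_states) (simp_all add: S0 vn_entropy_ghz_state)
    ultimately show False using ghz_state_neq by simp
  qed
  ultimately show ?thesis using ghz_state_in_states by blast
qed

end
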